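(* Let $\mathcal{C}\subset\mathbb{R}^N$ be a nonempty compact convex set with Euclidean projection $\pi_{\mathcal{C}}:\mathbb{R}^N\to\mathcal{C}$, and let $\mathcal{D}$ be a distribution of convex functions $\hat f:\mathbb{R}^N\to\mathbb{R}$ whose mean is the convex function $f$ (i.e. $E[\hat f]=f$ and $E[\partial\hat f]=\partial f$ is a subgradient of $f$). Assume a uniform bound $G$ on the norms of the subgradients, $\|\partial\hat f\|\le G$ for all $\hat f$ in the support of $\mathcal{D}$ and $\|\partial f\|\le G$. Let $u_{\mathrm{opt}}$ be a minimizer of $f$ on $\mathcal{C}$. Run the algorithm SSGD (described in the context) with smoothing radius $\varepsilon_{\mathrm{sm}}=\varepsilon$ and learning rates $\varepsilon_s=\varepsilon/\sqrt{s}$, starting from $u_1\in\mathcal{C}$. Then, in the asymptotic regime $\varepsilon\searrow 0$, if $$T\ge\left\lceil\frac{3G\,\mathrm{diam}\,\mathcal{C}}{2\varepsilon^3}+1\right\rceil^2-1=O(\varepsilon^{-6}),$$ with probability $\ge 1-2\varepsilon$ the algorithm returns a final point $u_{\mathrm{end}}$ satisfying $$f(u_{\mathrm{end}})-f(u_{\mathrm{opt}})\lessapprox 128G^2\varepsilon\log(1/\varepsilon).$$ On the other hand, in the case in which $\partial f$ is $L$-Lipschitz, one can achieve the same conclusion for $$T\ge\left\lceil\frac{3G\,\mathrm{diam}\,\mathcal{C}}{2\varepsilon^2}+1\right\rceil^2-1=O(\varepsilon^{-4})$$ (using the same algorithm without the smoothing perturbation, i.e. working directly with $f+2G\psi_{\mathcal{C}}$,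 and learning rates $\varepsilon_s=1/\sqrt{s}$).
   Context: Penalization function: for $x\in\partial\mathcal{C}$ let $S(x)$ be the set of unit vectors $v$ with $\sup_{y\in\mathcal{C}}\langle v,y-x\rangle\le 0$ (support vectors), and set $\psi_{\mathcal{C}}(y)=\sup_{x\in\partial\mathcal{C},\,v\in S(x)\cup\{0\}}\langle v,y-x\rangle$; $\psi_{\mathcal{C}}$ is convex, vanishes on $\mathcal{C}$, and admits a subgradient selection $\partial\psi_{\mathcal{C}}$ of norm at most $1$. Let $\eta_{\varepsilon_{\mathrm{sm}}}$ denote the uniform distribution on the closed ball of radius $\varepsilon_{\mathrm{sm}}$ centered at $0$. Algorithm SSGD (Smoothed Stochastic Gradient Descent): given $u_1\in\mathcal{C}$ and learning rates $\varepsilon_1,\dots,\varepsilon_T>0$, for $t=1,\dots,T$: sample $f_{t+1/2}$ from $\mathcal{D}$ independently of everything before; sample $v$ from $\eta_{\varepsilon_{\mathrm{sm}}}$ independently of everything before; set $u_{t+1}=u_t-\varepsilon_t\big[\partial f_{t+1/2}(u_t-v)+2G\,\partial\psi_{\mathcal{C}}(u_t-v)\big]$. Output $u_{\mathrm{end}}=\pi_{\mathcal{C}}(u_{T+1})$. Asymptotic notation: for a parameter $\varepsilon$, $a(\varepsilon)\lessapprox b(\varepsilon)$ means $\lim_{\varepsilon\searrow 0}a(\varepsilon)/b(\varepsilon)\le 1$ (the probability bound is understood in the same asymptotic sense). $\mathrm{diam}\,\mathcal{C}$ is the diameter of $\mathcal{C}$. *)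

theory Defs
  imports "HOL-Analysis.Analysis" "HOL-Probability.Probability"
begin

definition is_subgrad :: "('a::real_inner \<Rightarrow> real) \<Rightarrow> 'a \<Rightarrow> 'a \<Rightarrow> bool" where
  "is_subgrad h x g \<longleftrightarrow> (\<forall>y. h y \<ge> h x + g \<bullet> (y - x))"

definition support_vecs :: "'a::real_inner set \<Rightarrow> 'a \<Rightarrow> 'a set" where
  "support_vecs C x = {v. norm v = 1 \<and> (\<forall>y\<in>C. v \<bullet> (y - x) \<le> 0)}"

definition psiC :: "'a::euclidean_space set \<Rightarrow> 'a \<Rightarrow> real" where
  "psiC C y = (SUP p \<in> {(x, v). x \<in> frontier C \<and> v \<in> insert 0 (support_vecs C x)}.
                  snd p \<bullet> (y - fst p))"

definition eta :: "real \<Rightarrow> 'a::euclidean_space measure" where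
  "eta r = uniform_measure lborel (cball 0 r)"

text \<open>SGD iterates. With sample sequences ws (drawn functions, given through a parameter
  w and a subgradient selection gh w) and vs (smoothing perturbations),
  sgd_iter ... t is u_{t+1}; step t+1 uses learning rate lr (t+1).\<close>
fun sgd_iter :: "('w \<Rightarrow> 'a::real_vector \<Rightarrow> 'a) \<Rightarrow> ('a \<Rightarrow> 'a) \<Rightarrow> real \<Rightarrow> (nat \<Rightarrow> real)
                 \<Rightarrow> 'a \<Rightarrow> (nat \<Rightarrow> 'w) \<Rightarrow> (nat \<Rightarrow> 'a) \<Rightarrow> nat \<Rightarrow> 'a" where
  "sgd_iter gh dpsi G lr u1 ws vs 0 = u1"
| "sgd_iter gh dpsi G lr u1 ws vs (Suc t) =
     (let u = sgd_iter gh dpsi G lr u1 ws vs t; x = u - vs t in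
      u - lr (Suc t) *\<^sub>R (gh (ws t) x + (2 * G) *\<^sub>R dpsi x))"

text \<open>Output of SSGD (smoothed): sample space = i.i.d. pairs (f_{t+1/2}, v) per step.\<close>
definition ssgd_out :: "'a::euclidean_space set \<Rightarrow> ('w \<Rightarrow> 'a \<Rightarrow> 'a) \<Rightarrow> ('a \<Rightarrow> 'a) \<Rightarrow> real
                 \<Rightarrow> (nat \<Rightarrow> real) \<Rightarrow> 'a \<Rightarrow> nat \<Rightarrow> (nat \<Rightarrow> 'w \<times> 'a) \<Rightarrow> 'a" where
  "ssgd_out C gh dpsi G lr u1 T \<omega> =
     closest_point C (sgd_iter gh dpsi G lr u1 (\<lambda>t. fst (\<omega> t)) (\<lambda>t. snd (\<omega> t)) T)"

definition sgd_out :: "'a::euclidean_space set \<Rightarrow> ('w \<Rightarrow> 'a \<Rightarrow> 'a) \<Rightarrow> ('a \<Rightarrow> 'a) \<Rightarrow> real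
                 \<Rightarrow> (nat \<Rightarrow> real) \<Rightarrow> 'a \<Rightarrow> nat \<Rightarrow> (nat \<Rightarrow> 'w) \<Rightarrow> 'a" where
  "sgd_out C gh dpsi G lr u1 T \<omega> = closest_point C (sgd_iter gh dpsi G lr u1 \<omega> (\<lambda>_. 0) T)"

end

theory Submission
  imports Defs "HOL-Real_Asymp.Real_Asymp"
begin

text \<open>
  The penalized function \<open>F = f + 2G \<psi>\<close> is convex and \<open>3G\<close>-Lipschitz, is minimized by \<open>u_opt\<close> over
  the whole space, and satisfies \<open>f (\<pi> x) \<le> F x\<close>, since \<open>\<psi>\<close> dominates the distance to \<open>C\<close>. Hence SSGD is
  unconstrained stochastic gradient descent for \<open>F\<close>, or for the average of \<open>F\<close> over balls of radius
  \<open>\<epsilon>\<close>, which changes values by at most \<open>3G\<epsilon>\<close>.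

  The excess at the last iterate is compared with its averages over the last \<open>k + 1\<close> iterates,
  each of which is estimated with the iterate \<open>X (n - k)\<close> as comparison point. This gives, on
  every path, a deterministic bound plus a martingale term. Its mean vanishes, which bounds the
  expected excess of every iterate; this in turn bounds \<open>E \<bar>X t - X s\<bar>\<^sup>2\<close>, and, by orthogonality of the
  noise, the second moment of the martingale term. In both regimes the deterministic bound is
  \<open>o(\<epsilon> ln (1/\<epsilon>))\<close>, and the second moment is \<open>o(\<epsilon>\<^sup>3)\<close>, so that Chebyshev's inequality with a deviation
  of order \<open>\<epsilon> ln (1/\<epsilon>)\<close> has failure probability \<open>o(\<epsilon>)\<close>. The constants 128 and 2 are therefore not sharp.
\<close>

section \<open>Harmonic sums and averages\<close>

lemma sum_inverse_le_ln: "(\<Sum>t\<le>n. 1 / real (t + 1)) \<le> 1 + ln (real n + 1)"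
proof (induction n)
  case (Suc n)
  have "ln (1 + (-1 / (real n + 2))) \<le> -1 / (real n + 2)"
    by (rule ln_add_one_self_le_self2) (auto simp: field_simps)
  moreover have "1 + (-1 / (real n + 2)) = (real n + 1) / (real n + 2)"
    by (simp add: field_simps)
  ultimately have "1 / (real n + 2) \<le> ln (real n + 2) - ln (real n + 1)"
    by (simp add: ln_div)
  with Suc show ?case by (simp add: add_ac)
qed simp

text \<open>The summands decrease in \<open>t\<close>, so extending the window to earlier times can
  only raise its average. The average over the last \<open>k + 1\<close> terms is thus at most the
  one over all \<open>n + 1\<close> terms.\<close>

lemma tail_sum_inverse_le:
  assumes "k \<le> n"
  shows "(\<Sum>t=n-k..n. 1 / real (t + 1)) \<le> (1 + ln (real n + 1)) * real (k + 1) / real (n + 1)"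
proof -
  let ?A = "\<lambda>k. (\<Sum>t=n-k..n. 1 / real (t + 1)) / real (k + 1)"
  have "?A k \<le> ?A n"
    using assms
  proof (induction k rule: inc_induct)
    case (step k)
    define s where "s = n - Suc k"
    have s: "n - k = Suc s" "s \<le> n" using step.hyps by (auto simp: s_def)
    have eq: "{s..n} = insert s {Suc s..n}" using s by auto
    let ?B = "\<Sum>t=n-k..n. 1 / real (t + 1)"
    have "?B \<le> (\<Sum>t=n-k..n. 1 / real (s + 1))"
      by (intro sum_mono frac_le) (use s in auto)
    also have "\<dots> = real (k + 1) * (1 / real (s + 1))" using step.hyps by simp
    finally have "?B \<le> real (k + 1) * (1 / real (s + 1))" .
    moreover have aux: "b / a \<le> (b + c) / (a + 1)" if "b \<le> a * c" "0 < a" for a b c :: real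
      using that by (simp add: divide_simps algebra_simps)
    ultimately have "?B / real (k + 1) \<le> (?B + 1 / real (s + 1)) / (real (k + 1) + 1)"
      by (intro aux) simp_all
    also have "\<dots> = (?B + 1 / real (s + 1)) / real (Suc k + 1)"
      by simp
    also have "\<dots> = ?A (Suc k)"
      unfolding s_def[symmetric] eq using s by (simp add: add_ac)
    finally show ?case using step.IH by simp
  qed simp
  also have "?A n \<le> (1 + ln (real n + 1)) / real (n + 1)"
    using sum_inverse_le_ln[of n] by (simp add: divide_right_mono atMost_atLeast0)
  finally show ?thesis by (simp add: field_simps)
qed

text \<open>Rationalizing bounds each summand by twice an increment of the square root, and these
  increments telescope.\<close>

lemma sum_inverse_sqrt_le: "(\<Sum>t\<le>n. 1 / sqrt (real (t + 1))) \<le> 2 * sqrt (real n + 1)"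
proof (induction n)
  case (Suc n)
  let ?a = "sqrt (real n + 1)" and ?b = "sqrt (real n + 2)"
  have "1 = ?b\<^sup>2 - ?a\<^sup>2" by simp
  also have "\<dots> = (?b - ?a) * (?b + ?a)" by (simp add: power2_eq_square algebra_simps)
  also have "\<dots> \<le> (?b - ?a) * (2 * ?b)" by (intro mult_left_mono) auto
  finally have "1 / ?b \<le> 2 * (?b - ?a)" by (simp add: field_simps)
  with Suc show ?case by (simp add: add_ac)
qed simp

section \<open>Convolution-type sums of reciprocals\<close>

lemma sum_reflected: "(\<Sum>k=1..n. F (n - k + 1)) = (\<Sum>k=1..n. F k)" for F :: "nat \<Rightarrow> real"
  by (rule sum.reindex_bij_witness[of _ "\<lambda>k. n - k + 1" "\<lambda>k. n - k + 1"]) auto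

lemma sum_inverse_Icc_le_ln: "(\<Sum>k=1..n. 1 / real k) \<le> 1 + ln (real n + 1)"
proof (cases n)
  case (Suc m)
  have "(\<Sum>k=1..n. 1 / real k) = (\<Sum>t\<le>m. 1 / real (t + 1))"
    unfolding Suc by (rule sum.reindex_bij_witness[of _ Suc "\<lambda>k. k - 1"]) auto
  also have "\<dots> \<le> 1 + ln (real m + 1)" by (rule sum_inverse_le_ln)
  also have "\<dots> \<le> 1 + ln (real n + 1)" unfolding Suc by simp
  finally show ?thesis .
qed simp

text \<open>Partial fractions: \<open>1 / (k * m)\<close> with \<open>k + m = n + 1\<close> equals
  \<open>(1 / k + 1 / m) / (n + 1)\<close>, and reflection turns both parts into the same harmonic
  sum.\<close>

lemma sum_inverse_prod_le:
  "(\<Sum>k=1..n. 1 / (real k * real (n - k + 1))) \<le> 2 * (1 + ln (real n + 1)) / (real n + 1)"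
proof -
  have "(\<Sum>k=1..n. 1 / (real k * real (n - k + 1)))
      = (\<Sum>k=1..n. (1 / real k + 1 / real (n - k + 1)) / (real n + 1))"
    by (rule sum.cong) (auto simp: divide_simps of_nat_diff)
  also have "\<dots> = (2 * (\<Sum>k=1..n. 1 / real k)) / (real n + 1)"
    using sum_reflected[of "\<lambda>k. 1 / real k" n]
    by (simp add: sum_divide_distrib[symmetric] sum.distrib)
  also have "\<dots> \<le> 2 * (1 + ln (real n + 1)) / (real n + 1)"
    using sum_inverse_Icc_le_ln[of n] by (intro divide_right_mono) auto
  finally show ?thesis .
qed

text \<open>Writing \<open>1 / sqrt m = sqrt m / m\<close> with \<open>m \<le> n + 1\<close> reduces
  this to the preceding sum, at the cost of a factor \<open>sqrt (n + 1)\<close>.\<close>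

lemma sum_inverse_prod_sqrt_le:
  "(\<Sum>k=1..n. 1 / (real k * sqrt (real (n - k + 1)))) \<le> 2 * (1 + ln (real n + 1)) / sqrt (real n + 1)"
proof -
  have "(\<Sum>k=1..n. 1 / (real k * sqrt (real (n - k + 1))))
      \<le> (\<Sum>k=1..n. sqrt (real n + 1) * (1 / (real k * real (n - k + 1))))"
  proof (rule sum_mono)
    fix k assume k: "k \<in> {1..n}"
    define m where "m = real (n - k + 1)"
    have m: "0 < m" "m \<le> real n + 1" using k by (auto simp: m_def of_nat_diff)
    have "1 / (real k * sqrt m) = sqrt m * (1 / (real k * m))"
      using m k by (simp add: divide_simps)
    also have "\<dots> \<le> sqrt (real n + 1) * (1 / (real k * m))"
      using m by (intro mult_right_mono) auto
    finally show "1 / (real k * sqrt (real (n - k + 1)))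
        \<le> sqrt (real n + 1) * (1 / (real k * real (n - k + 1)))" unfolding m_def .
  qed
  also have "\<dots> = sqrt (real n + 1) * (\<Sum>k=1..n. 1 / (real k * real (n - k + 1)))"
    by (simp add: sum_distrib_left)
  also have "\<dots> \<le> sqrt (real n + 1) * (2 * (1 + ln (real n + 1)) / (real n + 1))"
    by (intro mult_left_mono sum_inverse_prod_le) auto
  also have "\<dots> = 2 * (1 + ln (real n + 1)) / sqrt (real n + 1)"
    by (simp add: divide_simps)
  finally show ?thesis .
qed

text \<open>Consecutive averages over the last \<open>k + 1\<close> and the last \<open>k\<close> terms differ by the \<open>k\<close>-th summand;
  monotonicity of \<open>h\<close> and nonnegativity of \<open>p\<close> replace \<open>h (n - k)\<close> by \<open>h t\<close> there.\<close>
lemma last_le_weighted_average: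
  fixes h p :: "nat \<Rightarrow> real"
  assumes h: "antimono h" and p: "\<And>t. 0 \<le> p t" and "m \<le> n"
  shows "h n * p n \<le> (\<Sum>t=n-m..n. h t * p t) / real (m + 1)
    + (\<Sum>k=1..m. (\<Sum>t=n-k..n. h t * (p t - p (n - k))) / (real k * real (k + 1)))"
  using \<open>m \<le> n\<close>
proof (induction m)
  case (Suc m)
  define s where "s = n - Suc m"
  have s: "n - m = Suc s" "s \<le> n" using Suc.prems by (auto simp: s_def)
  have eq: "{s..n} = insert s {Suc s..n}" using s by auto
  define A where "A = (\<Sum>t=n-m..n. h t * p t)"
  have AB: "(\<Sum>t=s..n. h t * p t) = A + h s * p s"
    unfolding A_def eq s by simp
  have "(\<Sum>t=s..n. h t * p s) \<le> (\<Sum>t=s..n. h s * p s)"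
    by (intro sum_mono mult_right_mono p antimonoD[OF h]) auto
  also have "\<dots> = real (m + 2) * (h s * p s)" using s Suc.prems by (simp add: s_def)
  finally have "(\<Sum>t=s..n. h t * (p t - p s)) \<ge> A - real (m + 1) * (h s * p s)"
    by (simp add: right_diff_distrib sum_subtractf AB algebra_simps)
  then have "(\<Sum>t=s..n. h t * (p t - p s)) / (real (m + 1) * real (m + 2))
      \<ge> (A - real (m + 1) * (h s * p s)) / (real (m + 1) * real (m + 2))"
    by (intro divide_right_mono) auto
  moreover have "A / real (m + 1) = (A + h s * p s) / real (m + 2)
      + (A - real (m + 1) * (h s * p s)) / (real (m + 1) * real (m + 2))"
    by (simp add: divide_simps) (simp add: algebra_simps)
  ultimately have "A / real (m + 1) \<le> (\<Sum>t=s..n. h t * p t) / real (m + 2)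
      + (\<Sum>t=s..n. h t * (p t - p s)) / (real (m + 1) * real (m + 2))"
    unfolding AB by linarith
  with Suc.IH Suc.prems show ?case by (simp add: A_def s_def add_ac)
qed simp

section \<open>Martingale noise in stochastic gradient descent\<close>

lemma subgrad_lipschitz:
  assumes sub: "\<And>x. is_subgrad h x (d x)" and d: "\<And>x. norm (d x) \<le> K"
  shows "\<bar>h x - h y\<bar> \<le> K * norm (x - y)"
proof -
  have "h x - h y \<le> K * norm (x - y)" for x y
  proof -
    have "h x - h y \<le> d x \<bullet> (x - y)"
      using sub[of x] unfolding is_subgrad_def by (simp add: inner_diff_right algebra_simps)
    also have "\<dots> \<le> norm (d x) * norm (x - y)" by (rule norm_cauchy_schwarz)
    also have "\<dots> \<le> K * norm (x - y)" by (intro mult_right_mono d) simp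
    finally show ?thesis .
  qed
  from this[of x y] this[of y x] show ?thesis by (simp add: norm_minus_commute abs_le_iff)
qed

lemma lipschitz_abs_continuous:
  fixes h :: "'a::real_normed_vector \<Rightarrow> real"
  assumes "\<And>x y. \<bar>h x - h y\<bar> \<le> K * norm (x - y)" "0 \<le> K"
  shows "continuous_on S h"
proof -
  have "K-lipschitz_on S h" using assms by (intro lipschitz_onI) (auto simp: dist_norm)
  then show ?thesis by (rule lipschitz_on_continuous_on)
qed

text \<open>Both versions of the algorithm are instances: \<open>s\<close> is one sample and
  \<open>H s x\<close> the resulting direction, whose mean is a subgradient of
  \<open>\<Phi>\<close>. The comparison point \<open>z\<close> need only be optimal up to
  \<open>e\<close>, because a minimizer of the penalized function is merely almost optimal for its
  smoothed version.\<close>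

locale sgd_process = prob_space M for M :: "'s measure" +
  fixes H :: "'s \<Rightarrow> 'a::euclidean_space \<Rightarrow> 'a"
    and \<Phi> :: "'a \<Rightarrow> real" and x0 z :: 'a and K \<eta> m e :: real
  assumes H_meas: "(\<lambda>(s, x). H s x) \<in> borel_measurable (M \<Otimes>\<^sub>M borel)"
    and H_bound: "\<And>s x. s \<in> space M \<Longrightarrow> norm (H s x) \<le> K"
    and subgrad: "\<And>x. is_subgrad \<Phi> x (\<integral>s. H s x \<partial>M)"
    and \<Phi>_ge: "\<And>x. m \<le> \<Phi> x"
    and \<Phi>_z: "\<Phi> z \<le> m + e"
    and \<eta>_pos: "0 < \<eta>"
begin

abbreviation P :: "(nat \<Rightarrow> 's) measure" where
  "P \<equiv> PiM UNIV (\<lambda>_. M)"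

definition g :: "'a \<Rightarrow> 'a" where
  "g x = (\<integral>s. H s x \<partial>M)"

text \<open>Steps are counted from 0 here, so \<open>rate t\<close> is the learning rate number
  \<open>t + 1\<close> of the algorithm.\<close>

definition rate :: "nat \<Rightarrow> real" where
  "rate t = \<eta> / sqrt (real (Suc t))"

primrec X :: "nat \<Rightarrow> (nat \<Rightarrow> 's) \<Rightarrow> 'a" where
  "X 0 \<omega> = x0"
| "X (Suc t) \<omega> = X t \<omega> - rate t *\<^sub>R H (\<omega> t) (X t \<omega>)"

definition noise :: "nat \<Rightarrow> (nat \<Rightarrow> 's) \<Rightarrow> 'a" where
  "noise t \<omega> = H (\<omega> t) (X t \<omega>) - g (X t \<omega>)"

text \<open>Boundedness is included so that all expectations below exist.\<close>
definition past :: "nat \<Rightarrow> ((nat \<Rightarrow> 's) \<Rightarrow> 'b::{second_countable_topology,banach}) \<Rightarrow> bool" where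
  "past t Y \<longleftrightarrow> Y \<in> borel_measurable P \<and> (\<exists>B. \<forall>\<omega>\<in>space P. norm (Y \<omega>) \<le> B) \<and>
     (\<forall>\<omega>\<in>space P. \<forall>s\<in>space M. \<forall>i\<ge>t. Y (\<omega> (i := s)) = Y \<omega>)"

sublocale P: prob_space P
  by (rule prob_space_PiM) (rule prob_space_axioms)

lemma space_P_apply: "\<omega> \<in> space P \<Longrightarrow> \<omega> t \<in> space M"
  by (auto simp: space_PiM)

lemma K_nonneg: "0 \<le> K"
proof -
  obtain s where "s \<in> space M" using not_empty by blast
  then show ?thesis using H_bound[of s 0] norm_ge_zero order_trans by blast
qed

lemma rate_pos: "0 < rate t"
  using \<eta>_pos by (simp add: rate_def)

lemma rate_antimono: "antimono rate"
  using \<eta>_pos by (auto simp: rate_def antimono_def intro!: divide_left_mono mult_pos_pos)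

lemma rate_sq: "(rate t)\<^sup>2 = \<eta>\<^sup>2 * (1 / real (t + 1))"
  by (simp add: rate_def power_divide)

lemma e_nonneg: "0 \<le> e"
  using \<Phi>_ge[of z] \<Phi>_z by simp

lemma H_measurable [measurable]: "(\<lambda>s. H s x) \<in> borel_measurable M"
  using measurable_compose[OF measurable_Pair2' H_meas, of x] by simp

lemma H_integrable: "integrable M (\<lambda>s. H s x)"
  by (rule integrable_const_bound[of _ K]) (auto intro!: AE_I2 H_bound)

lemma g_measurable [measurable]: "g \<in> borel_measurable borel"
proof -
  have "(\<lambda>(x, s). H s x) \<in> borel_measurable (borel \<Otimes>\<^sub>M M)"
    using measurable_compose[OF measurable_pair_swap' H_meas] by (simp add: case_prod_beta')
  then show ?thesis unfolding g_def[abs_def]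
    by (rule borel_measurable_lebesgue_integral)
qed

lemma norm_g: "norm (g x) \<le> K"
proof -
  have "norm (g x) \<le> (\<integral>s. norm (H s x) \<partial>M)" unfolding g_def by (rule integral_norm_bound)
  also have "\<dots> \<le> (\<integral>s. K \<partial>M)"
    by (intro integral_mono integrable_norm H_integrable) (auto intro: H_bound)
  finally show ?thesis by (simp add: prob_space)
qed

lemma \<Phi>_ge_linear: "\<Phi> x + g x \<bullet> (y - x) \<le> \<Phi> y"
  using subgrad[of x] by (simp add: is_subgrad_def g_def)

lemma \<Phi>_lipschitz: "\<bar>\<Phi> x - \<Phi> y\<bar> \<le> K * norm (x - y)"
  by (rule subgrad_lipschitz[OF subgrad]) (use norm_g in \<open>simp add: g_def\<close>)

lemma \<Phi>_measurable [measurable]: "\<Phi> \<in> borel_measurable borel"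
  by (rule borel_measurable_continuous_onI, rule lipschitz_abs_continuous[OF \<Phi>_lipschitz K_nonneg])

section \<open>Closure properties of bounded functions of the samples before time t\<close>

lemma past_measurable: "past t Y \<Longrightarrow> Y \<in> borel_measurable P"
  by (simp add: past_def)

lemma past_upd: "past t Y \<Longrightarrow> \<omega> \<in> space P \<Longrightarrow> s \<in> space M \<Longrightarrow> t \<le> i \<Longrightarrow> Y (\<omega> (i := s)) = Y \<omega>"
  by (simp add: past_def)

lemma past_integrable: "past t Y \<Longrightarrow> integrable P Y"
  unfolding past_def by (auto intro!: P.integrable_const_bound AE_I2)

lemma past_mono: "past s Y \<Longrightarrow> s \<le> t \<Longrightarrow> past t Y"
  unfolding past_def by (meson le_trans)

lemma past_const [intro]: "past t (\<lambda>_. c)"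
  unfolding past_def by auto

lemma past_add [intro]:
  assumes "past t Y" "past t Z" shows "past t (\<lambda>\<omega>. Y \<omega> + Z \<omega>)"
proof -
  obtain A B where "\<forall>\<omega>\<in>space P. norm (Y \<omega>) \<le> A" "\<forall>\<omega>\<in>space P. norm (Z \<omega>) \<le> B"
    using assms by (auto simp: past_def)
  then have "\<forall>\<omega>\<in>space P. norm (Y \<omega> + Z \<omega>) \<le> A + B"
    by (auto intro: norm_triangle_mono)
  then show ?thesis using assms unfolding past_def by auto
qed

lemma past_scaleR [intro]:
  assumes "past t Y" shows "past t (\<lambda>\<omega>. c *\<^sub>R Y \<omega>)"
proof -
  obtain A where "\<forall>\<omega>\<in>space P. norm (Y \<omega>) \<le> A" using assms by (auto simp: past_def)
  then have "\<forall>\<omega>\<in>space P. norm (c *\<^sub>R Y \<omega>) \<le> \<bar>c\<bar> * A" by (auto intro: mult_left_mono)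
  then show ?thesis using assms unfolding past_def by auto
qed

lemma past_diff [intro]:
  assumes "past t Y" "past t Z" shows "past t (\<lambda>\<omega>. Y \<omega> - Z \<omega>)"
  using past_add[OF assms(1) past_scaleR[OF assms(2), of "-1"]] by simp

lemma past_inner [intro]:
  fixes Y Z :: "(nat \<Rightarrow> 's) \<Rightarrow> 'b::euclidean_space"
  assumes "past t Y" "past t Z" shows "past t (\<lambda>\<omega>. Y \<omega> \<bullet> Z \<omega>)"
proof -
  obtain A B where AB: "\<forall>\<omega>\<in>space P. norm (Y \<omega>) \<le> A" "\<forall>\<omega>\<in>space P. norm (Z \<omega>) \<le> B"
    using assms by (auto simp: past_def)
  have "norm (Y \<omega> \<bullet> Z \<omega>) \<le> A * B" if "\<omega> \<in> space P" for \<omega>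
  proof -
    have "norm (Y \<omega> \<bullet> Z \<omega>) \<le> norm (Y \<omega>) * norm (Z \<omega>)" by (simp add: Cauchy_Schwarz_ineq2)
    also have "\<dots> \<le> A * B" using AB that norm_ge_zero order_trans by (intro mult_mono) blast+
    finally show ?thesis .
  qed
  then show ?thesis using assms unfolding past_def by auto
qed

lemma past_mult [intro]:
  fixes Y Z :: "(nat \<Rightarrow> 's) \<Rightarrow> real"
  assumes "past t Y" "past t Z" shows "past t (\<lambda>\<omega>. Y \<omega> * Z \<omega>)"
  using past_inner[OF assms] by simp

lemma past_sum [intro]:
  assumes "\<And>i. i \<in> I \<Longrightarrow> past t (Y i)" shows "past t (\<lambda>\<omega>. \<Sum>i\<in>I. Y i \<omega>)"
  using assms by (induction I rule: infinite_finite_induct) auto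

lemma past_norm_sq [intro]: "past t Y \<Longrightarrow> past t (\<lambda>\<omega>. (norm (Y \<omega>))\<^sup>2)"
  for Y :: "(nat \<Rightarrow> 's) \<Rightarrow> 'b::euclidean_space"
  using past_inner[of t Y Y] by (simp add: power2_norm_eq_inner)

text \<open>The direction at time \<open>t\<close> also uses sample \<open>t\<close>, which moves
  the index on by one.\<close>

lemma past_H:
  assumes "past t Y" shows "past (Suc t) (\<lambda>\<omega>. H (\<omega> t) (Y \<omega>))"
proof -
  have [measurable]: "Y \<in> borel_measurable P" using assms by (rule past_measurable)
  have "(\<lambda>\<omega>. (\<omega> t, Y \<omega>)) \<in> P \<rightarrow>\<^sub>M M \<Otimes>\<^sub>M borel" by measurable
  from measurable_compose[OF this H_meas] have "(\<lambda>\<omega>. H (\<omega> t) (Y \<omega>)) \<in> borel_measurable P" by simp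
  moreover have "\<exists>B. \<forall>\<omega>\<in>space P. norm (H (\<omega> t) (Y \<omega>)) \<le> B"
    by (intro exI[of _ K] ballI H_bound space_P_apply)
  ultimately show ?thesis using past_upd[OF assms] by (auto simp: past_def)
qed

lemma past_X: "past t (X t)"
proof (induction t)
  case (Suc t)
  then show ?case unfolding X.simps by (intro past_diff past_scaleR past_H) (auto intro: past_mono)
qed (simp add: past_const)

lemma past_noise: "past (Suc t) (noise t)"
proof -
  have [measurable]: "X t \<in> borel_measurable P" by (rule past_measurable[OF past_X])
  have "past t (\<lambda>\<omega>. g (X t \<omega>))"
    using norm_g past_upd[OF past_X] unfolding past_def by (intro conjI) auto
  then show ?thesis unfolding noise_def[abs_def]
    by (intro past_diff past_H past_X) (auto intro: past_mono)
qed

lemma past_\<Phi>: 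
  assumes "past t Y" shows "past t (\<lambda>\<omega>. \<Phi> (Y \<omega>))"
proof -
  have [measurable]: "Y \<in> borel_measurable P" using assms by (rule past_measurable)
  obtain A where A: "\<forall>\<omega>\<in>space P. norm (Y \<omega>) \<le> A" using assms by (auto simp: past_def)
  have "norm (\<Phi> (Y \<omega>)) \<le> \<bar>\<Phi> 0\<bar> + K * A" if "\<omega> \<in> space P" for \<omega>
  proof -
    have "K * norm (Y \<omega>) \<le> K * A" using A that K_nonneg by (auto intro: mult_left_mono)
    then show ?thesis using \<Phi>_lipschitz[of "Y \<omega>" 0] by simp
  qed
  then show ?thesis using past_upd[OF assms] unfolding past_def by auto
qed

lemma noise_bound:
  assumes "\<omega> \<in> space P" shows "norm (noise t \<omega>) \<le> 2 * K"
proof -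
  have "norm (noise t \<omega>) \<le> norm (H (\<omega> t) (X t \<omega>)) + norm (g (X t \<omega>))"
    unfolding noise_def by (rule norm_triangle_ineq4)
  also have "\<dots> \<le> K + K" by (intro add_mono norm_g H_bound space_P_apply assms)
  finally show ?thesis by simp
qed

text \<open>The martingale property, without conditional expectations: redrawing sample
  \<open>t\<close> independently preserves the law \<open>P\<close> and affects neither
  \<open>X t\<close> nor \<open>Y\<close>. Integrating over the fresh sample first gives zero,
  because \<open>g\<close> is the mean of \<open>H\<close>.\<close>

lemma expectation_noise:
  assumes "past t Y" shows "P.expectation (\<lambda>\<omega>. noise t \<omega> \<bullet> Y \<omega>) = 0"
proof -
  let ?F = "\<lambda>\<omega>. noise t \<omega> \<bullet> Y \<omega>"
  let ?u = "\<lambda>(s, \<omega>). \<omega> (t := s)"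
  interpret MP: pair_prob_space M P ..
  have past: "past (Suc t) ?F" using assms by (intro past_inner past_noise) (auto intro: past_mono)
  have [measurable]: "?F \<in> borel_measurable P" by (rule past_measurable[OF past])
  have distr: "distr (M \<Otimes>\<^sub>M P) P ?u = P"
    using distr_pair_PiM_eq_PiM[of UNIV "\<lambda>_. M" t] prob_space_axioms by (simp add: case_prod_beta')
  have u: "?u \<in> M \<Otimes>\<^sub>M P \<rightarrow>\<^sub>M P"
    using measurable_compose[OF measurable_pair_swap' measurable_add_dim[of t UNIV "\<lambda>_. M"]]
    by (simp add: case_prod_beta')
  have "integrable (distr (M \<Otimes>\<^sub>M P) P ?u) ?F"
    unfolding distr by (rule past_integrable[OF past])
  from integrable_distr[OF u this]
  have int: "integrable (M \<Otimes>\<^sub>M P) (\<lambda>(s, \<omega>). ?F (\<omega> (t := s)))"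
    by (simp only: case_prod_beta')
  have "P.expectation ?F = (\<integral>\<omega>. ?F \<omega> \<partial>distr (M \<Otimes>\<^sub>M P) P ?u)" unfolding distr ..
  also have "\<dots> = (\<integral>x. ?F (?u x) \<partial>(M \<Otimes>\<^sub>M P))"
    by (rule integral_distr[OF u]) measurable
  also have "\<dots> = (\<integral>(s, \<omega>). ?F (\<omega> (t := s)) \<partial>(M \<Otimes>\<^sub>M P))"
    by (simp only: case_prod_beta')
  also have "\<dots> = (\<integral>\<omega>. (\<integral>s. ?F (\<omega> (t := s)) \<partial>M) \<partial>P)"
    by (rule MP.integral_snd[OF int, symmetric])
  also have "\<dots> = (\<integral>\<omega>. 0 \<partial>P)"
  proof (rule Bochner_Integration.integral_cong[OF refl])
    fix \<omega> assume \<omega>: "\<omega> \<in> space P"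
    have "(\<integral>s. ?F (\<omega> (t := s)) \<partial>M) = (\<integral>s. (H s (X t \<omega>) - g (X t \<omega>)) \<bullet> Y \<omega> \<partial>M)"
      using past_upd[OF past_X \<omega>] past_upd[OF assms \<omega>]
      by (intro Bochner_Integration.integral_cong) (auto simp: noise_def)
    also have "\<dots> = (\<integral>s. H s (X t \<omega>) - g (X t \<omega>) \<partial>M) \<bullet> Y \<omega>"
      by (intro integral_inner_left) (auto intro: H_integrable)
    also have "(\<integral>s. H s (X t \<omega>) - g (X t \<omega>) \<partial>M) = 0"
      by (simp add: H_integrable g_def prob_space)
    finally show "(\<integral>s. ?F (\<omega> (t := s)) \<partial>M) = 0" by (simp only: inner_zero_left)
  qed
  finally show ?thesis by simp
qed

end

section \<open>Pathwise and mean bounds for the last iterate\<close>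

text \<open>Cauchy-Schwarz with the weight \<open>1 / k\<close> shared evenly between the two
  factors. One of them is then a harmonic sum, so only a logarithm is lost.\<close>

lemma weighted_sum_sq_le:
  "(\<Sum>k=1..n. c k / (real k * real (k + 1)))\<^sup>2
    \<le> (1 + ln (real n + 1)) * (\<Sum>k=1..n. (c k)\<^sup>2 / (real k * (real (k + 1))\<^sup>2))"
proof -
  have "(\<Sum>k=1..n. c k / (real k * real (k + 1)))
      = (\<Sum>k=1..n. (1 / sqrt (real k)) * (c k / (sqrt (real k) * real (k + 1))))"
    by (rule sum.cong) auto
  then have "(\<Sum>k=1..n. c k / (real k * real (k + 1)))\<^sup>2
      \<le> (\<Sum>k=1..n. (1 / sqrt (real k))\<^sup>2) * (\<Sum>k=1..n. (c k / (sqrt (real k) * real (k + 1)))\<^sup>2)"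
    by (simp only: Cauchy_Schwarz_ineq_sum)
  also have "\<dots> = (\<Sum>k=1..n. 1 / real k) * (\<Sum>k=1..n. (c k)\<^sup>2 / (real k * (real (k + 1))\<^sup>2))"
    by (simp add: power_divide power_mult_distrib)
  also have "\<dots> \<le> (1 + ln (real n + 1)) * (\<Sum>k=1..n. (c k)\<^sup>2 / (real k * (real (k + 1))\<^sup>2))"
    by (intro mult_right_mono sum_inverse_Icc_le_ln sum_nonneg) auto
  finally show ?thesis .
qed

text \<open>An upper bound for the expected excess of iterate \<open>n\<close>, with
  \<open>R\<close> the initial distance to the comparison point. It stands outside the locale as a
  function of real parameters, ready for the asymptotics.\<close>

definition gap_rate :: "real \<Rightarrow> real \<Rightarrow> real \<Rightarrow> real \<Rightarrow> nat \<Rightarrow> real" where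
  "gap_rate R K \<eta> e n = (R\<^sup>2 / \<eta> + 2 * K\<^sup>2 * \<eta> * (1 + ln (real n + 1))\<^sup>2) / (2 * sqrt (real n + 1)) + 2 * e"

context sgd_process
begin

section \<open>Martingale transforms of the noise\<close>

lemma past_scaleR_fun [intro]:
  fixes Z :: "(nat \<Rightarrow> 's) \<Rightarrow> 'b::euclidean_space"
  assumes "past t Y" "past t Z" shows "past t (\<lambda>\<omega>. Y \<omega> *\<^sub>R Z \<omega>)"
proof -
  obtain A B where AB: "\<forall>\<omega>\<in>space P. norm (Y \<omega>) \<le> A" "\<forall>\<omega>\<in>space P. norm (Z \<omega>) \<le> B"
    using assms by (auto simp: past_def)
  have "norm (Y \<omega> *\<^sub>R Z \<omega>) \<le> A * B" if "\<omega> \<in> space P" for \<omega>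
    using mult_mono[of "norm (Y \<omega>)" A "norm (Z \<omega>)" B] AB that order_trans[OF norm_ge_zero, of "Y \<omega>" A]
    by auto
  then show ?thesis using assms unfolding past_def by auto
qed

text \<open>The noise summed against the vectors \<open>Y t\<close>. The increments are those of a
  martingale when each \<open>Y t\<close> is settled before sample \<open>t\<close> is
  drawn.\<close>

definition mart :: "nat \<Rightarrow> nat \<Rightarrow> (nat \<Rightarrow> (nat \<Rightarrow> 's) \<Rightarrow> 'a) \<Rightarrow> (nat \<Rightarrow> 's) \<Rightarrow> real" where
  "mart s n Y \<omega> = (\<Sum>t=s..<n. rate t * (noise t \<omega> \<bullet> Y t \<omega>))"

lemma past_mart:
  assumes "\<And>t. s \<le> t \<Longrightarrow> t < n \<Longrightarrow> past t (Y t)"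
  shows "past n (mart s n Y)"
  unfolding mart_def[abs_def]
proof (intro past_sum past_mult past_const past_inner)
  fix t assume "t \<in> {s..<n}"
  then show "past n (noise t)" "past n (Y t)"
    using past_mono[OF past_noise] past_mono[OF assms] by auto
qed

lemma expectation_mart:
  assumes "\<And>t. s \<le> t \<Longrightarrow> t < n \<Longrightarrow> past t (Y t)"
  shows "P.expectation (mart s n Y) = 0"
proof -
  have "past (Suc t) (\<lambda>\<omega>. noise t \<omega> \<bullet> Y t \<omega>)" if "t \<in> {s..<n}" for t
    using that past_mono[OF assms, of t "Suc t"] by (intro past_inner past_noise) auto
  then have "integrable P (\<lambda>\<omega>. noise t \<omega> \<bullet> Y t \<omega>)" if "t \<in> {s..<n}" for t
    using past_integrable that by blast
  then have "P.expectation (mart s n Y)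
      = (\<Sum>t=s..<n. rate t * P.expectation (\<lambda>\<omega>. noise t \<omega> \<bullet> Y t \<omega>))"
    unfolding mart_def[abs_def] by (subst Bochner_Integration.integral_sum) auto
  also have "\<dots> = 0" by (simp add: expectation_noise assms)
  finally show ?thesis .
qed

text \<open>Increments at different times are orthogonal, so only the second moments of the single
  increments add up; each is controlled by the pathwise bound \<open>2 * K\<close> on the
  noise.\<close>

lemma expectation_mart_sq_le:
  assumes "\<And>t. s \<le> t \<Longrightarrow> t < n \<Longrightarrow> past t (Y t)"
  shows "P.expectation (\<lambda>\<omega>. (mart s n Y \<omega>)\<^sup>2)
    \<le> 4 * K\<^sup>2 * (\<Sum>t=s..<n. (rate t)\<^sup>2 * P.expectation (\<lambda>\<omega>. (norm (Y t \<omega>))\<^sup>2))"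
  using assms
proof (induction n)
  case 0
  then show ?case by (simp add: mart_def)
next
  case (Suc n)
  show ?case
  proof (cases "s \<le> n")
    case True
    let ?m = "mart s n Y" and ?d = "\<lambda>\<omega>. noise n \<omega> \<bullet> Y n \<omega>"
    have pm: "past n ?m" using Suc.prems by (intro past_mart) auto
    have pY: "past n (Y n)" using Suc.prems True by auto
    have pd: "past (Suc n) ?d" by (intro past_inner past_noise past_mono[OF pY]) auto
    have pm': "past (Suc n) ?m" using pm by (rule past_mono) simp
    \<comment> \<open>The earlier sum is a scalar known before sample \<open>n\<close>, so it can be
      moved into the test vector of \<open>expectation_noise\<close>.\<close>
    have "P.expectation (\<lambda>\<omega>. ?m \<omega> * ?d \<omega>) = P.expectation (\<lambda>\<omega>. noise n \<omega> \<bullet> (?m \<omega> *\<^sub>R Y n \<omega>))"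
      by simp
    also have "\<dots> = 0" by (intro expectation_noise past_scaleR_fun pm pY)
    finally have cross: "P.expectation (\<lambda>\<omega>. ?m \<omega> * ?d \<omega>) = 0" .
    have "mart s (Suc n) Y \<omega> = ?m \<omega> + rate n * ?d \<omega>" for \<omega>
      using True by (simp add: mart_def)
    then have "P.expectation (\<lambda>\<omega>. (mart s (Suc n) Y \<omega>)\<^sup>2)
        = P.expectation (\<lambda>\<omega>. (?m \<omega> * ?m \<omega> + (2 * rate n) * (?m \<omega> * ?d \<omega>))
            + (rate n)\<^sup>2 * (?d \<omega> * ?d \<omega>))"
      by (simp add: power2_eq_square algebra_simps)
    also have "\<dots> = P.expectation (\<lambda>\<omega>. ?m \<omega> * ?m \<omega>)
        + (rate n)\<^sup>2 * P.expectation (\<lambda>\<omega>. ?d \<omega> * ?d \<omega>)"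
      by (subst Bochner_Integration.integral_add Bochner_Integration.integral_mult_right_zero;
          (intro past_integrable[of "Suc n"] past_add past_mult past_const pm' pd)?)+
         (simp add: cross)
    finally have eq: "P.expectation (\<lambda>\<omega>. (mart s (Suc n) Y \<omega>)\<^sup>2)
        = P.expectation (\<lambda>\<omega>. ?m \<omega> * ?m \<omega>) + (rate n)\<^sup>2 * P.expectation (\<lambda>\<omega>. ?d \<omega> * ?d \<omega>)" .
    have "P.expectation (\<lambda>\<omega>. ?d \<omega> * ?d \<omega>)
        \<le> P.expectation (\<lambda>\<omega>. 4 * K\<^sup>2 * (norm (Y n \<omega>))\<^sup>2)"
    proof (rule integral_mono)
      fix \<omega> assume \<omega>: "\<omega> \<in> space P"
      have "\<bar>?d \<omega>\<bar> \<le> norm (noise n \<omega>) * norm (Y n \<omega>)" by (rule Cauchy_Schwarz_ineq2)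
      also have "\<dots> \<le> (2 * K) * norm (Y n \<omega>)" by (intro mult_right_mono noise_bound \<omega>) simp
      finally have "\<bar>?d \<omega>\<bar>\<^sup>2 \<le> ((2 * K) * norm (Y n \<omega>))\<^sup>2" by (rule power_mono) simp
      then show "?d \<omega> * ?d \<omega> \<le> 4 * K\<^sup>2 * (norm (Y n \<omega>))\<^sup>2"
        by (simp add: power2_eq_square algebra_simps)
    qed (intro past_integrable[of "Suc n"] past_mult past_const past_norm_sq pd past_mono[OF pY] le_SucI order_refl)+
    then have "(rate n)\<^sup>2 * P.expectation (\<lambda>\<omega>. ?d \<omega> * ?d \<omega>)
        \<le> (rate n)\<^sup>2 * (4 * K\<^sup>2 * P.expectation (\<lambda>\<omega>. (norm (Y n \<omega>))\<^sup>2))"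
      by (intro mult_left_mono) auto
    moreover have "P.expectation (\<lambda>\<omega>. ?m \<omega> * ?m \<omega>)
        \<le> 4 * K\<^sup>2 * (\<Sum>t=s..<n. (rate t)\<^sup>2 * P.expectation (\<lambda>\<omega>. (norm (Y t \<omega>))\<^sup>2))"
      using Suc by (simp add: power2_eq_square)
    ultimately show ?thesis unfolding eq using True by (simp add: algebra_simps)
  qed (simp add: mart_def)
qed

text \<open>Expand the square of \<open>X (Suc t) - y\<close>, split the direction into
  \<open>g\<close> plus noise, and bound the part with \<open>g\<close> from below by
  convexity.\<close>

lemma one_step:
  assumes "\<omega> \<in> space P"
  shows "rate t * (\<Phi> (X t \<omega>) - \<Phi> y)
    \<le> ((norm (X t \<omega> - y))\<^sup>2 - (norm (X (Suc t) \<omega> - y))\<^sup>2) / 2 + K\<^sup>2 / 2 * (rate t)\<^sup>2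
      - rate t * (noise t \<omega> \<bullet> (X t \<omega> - y))"
proof -
  define x h where "x = X t \<omega>" and "h = H (\<omega> t) x"
  have "\<Phi> x - \<Phi> y \<le> g x \<bullet> (x - y)" using \<Phi>_ge_linear[of x y] by (simp add: inner_diff_right)
  then have "rate t * (\<Phi> x - \<Phi> y) \<le> rate t * (g x \<bullet> (x - y))"
    using rate_pos[of t] by (intro mult_left_mono) auto
  moreover have "(rate t)\<^sup>2 * (norm h)\<^sup>2 \<le> (rate t)\<^sup>2 * K\<^sup>2"
    unfolding h_def by (intro mult_left_mono power_mono H_bound space_P_apply assms) auto
  moreover have "(norm (x - rate t *\<^sub>R h - y))\<^sup>2
      = (norm (x - y))\<^sup>2 - 2 * rate t * (h \<bullet> (x - y)) + (rate t)\<^sup>2 * (norm h)\<^sup>2"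
    unfolding power2_norm_eq_inner
    by (simp add: inner_diff_left inner_diff_right inner_commute algebra_simps power2_eq_square)
  ultimately show ?thesis
    by (simp add: x_def[symmetric] h_def[symmetric] noise_def inner_diff_left algebra_simps diff_divide_distrib)
qed

text \<open>The inequality is purely pathwise, so \<open>y\<close> may depend on the path; this
  admits an earlier iterate as comparison point.\<close>

lemma telescoped:
  assumes "\<omega> \<in> space P" "s \<le> n"
  shows "(\<Sum>t=s..<n. rate t * (\<Phi> (X t \<omega>) - \<Phi> (y \<omega>)))
    \<le> ((norm (X s \<omega> - y \<omega>))\<^sup>2 - (norm (X n \<omega> - y \<omega>))\<^sup>2) / 2 + K\<^sup>2 / 2 * (\<Sum>t=s..<n. (rate t)\<^sup>2)
      - mart s n (\<lambda>t \<omega>. X t \<omega> - y \<omega>) \<omega>"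
  using assms(2)
proof (induction n rule: dec_induct)
  case base
  then show ?case by (simp add: mart_def)
next
  case (step n)
  have "mart s (Suc n) (\<lambda>t \<omega>. X t \<omega> - y \<omega>) \<omega>
      = mart s n (\<lambda>t \<omega>. X t \<omega> - y \<omega>) \<omega> + rate n * (noise n \<omega> \<bullet> (X n \<omega> - y \<omega>))"
    using step.hyps by (simp add: mart_def)
  moreover have "K\<^sup>2 / 2 * (\<Sum>t=s..<Suc n. (rate t)\<^sup>2) = K\<^sup>2 / 2 * (\<Sum>t=s..<n. (rate t)\<^sup>2) + K\<^sup>2 / 2 * (rate n)\<^sup>2"
    using step.hyps by (simp add: algebra_simps)
  moreover have "(\<Sum>t=s..<Suc n. rate t * (\<Phi> (X t \<omega>) - \<Phi> (y \<omega>)))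
      = (\<Sum>t=s..<n. rate t * (\<Phi> (X t \<omega>) - \<Phi> (y \<omega>))) + rate n * (\<Phi> (X n \<omega>) - \<Phi> (y \<omega>))"
    using step.hyps by simp
  ultimately show ?case
    using step.IH one_step[OF assms(1), of n "y \<omega>"] by (simp only: diff_divide_distrib)
qed

lemma sum_rate_le: "(\<Sum>t\<le>n. rate t) \<le> 2 * \<eta> * sqrt (real n + 1)"
proof -
  have "(\<Sum>t\<le>n. rate t) = \<eta> * (\<Sum>t\<le>n. 1 / sqrt (real (t + 1)))"
    by (simp add: rate_def sum_distrib_left)
  also have "\<dots> \<le> \<eta> * (2 * sqrt (real n + 1))"
    using \<eta>_pos by (intro mult_left_mono sum_inverse_sqrt_le) auto
  finally show ?thesis by simp
qed

lemma sum_rate_sq_tail_le: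
  assumes "k \<le> n"
  shows "(\<Sum>t=n-k..n. (rate t)\<^sup>2) \<le> \<eta>\<^sup>2 * ((1 + ln (real n + 1)) * real (k + 1) / real (n + 1))"
  unfolding rate_sq sum_distrib_left[symmetric]
  by (intro mult_left_mono tail_sum_inverse_le assms) auto

lemma sum_rate_sq_le: "(\<Sum>t\<le>n. (rate t)\<^sup>2) \<le> \<eta>\<^sup>2 * (1 + ln (real n + 1))"
  unfolding rate_sq sum_distrib_left[symmetric]
  by (intro mult_left_mono sum_inverse_le_ln) auto

section \<open>The noise entering the last iterate\<close>

abbreviation "gap_bound \<equiv> gap_rate (norm (x0 - z)) K \<eta> e"

text \<open>Noise of the whole run relative to \<open>z\<close>. The sum ends at
  \<open>Suc n\<close> (exclusive) because telescoping the excess up to iterate \<open>n\<close>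
  uses the step out of that iterate.\<close>

definition martz :: "nat \<Rightarrow> (nat \<Rightarrow> 's) \<Rightarrow> real" where
  "martz n = mart 0 (Suc n) (\<lambda>t \<omega>. X t \<omega> - z)"

text \<open>Noise of the last \<open>k + 1\<close> steps relative to the iterate at which they
  start.\<close>

definition martk :: "nat \<Rightarrow> nat \<Rightarrow> (nat \<Rightarrow> 's) \<Rightarrow> real" where
  "martk n k = mart (n - k) (Suc n) (\<lambda>t \<omega>. X t \<omega> - X (n - k) \<omega>)"

text \<open>The weights are those with which \<open>last_le_weighted_average\<close> combines the
  full average and the windows of \<open>k + 1\<close> terms.\<close>

definition total_noise :: "nat \<Rightarrow> (nat \<Rightarrow> 's) \<Rightarrow> real" where
  "total_noise n \<omega> = martz n \<omega> / real (n + 1)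
     + (\<Sum>k=1..n. martk n k \<omega> / (real k * real (k + 1)))"

lemma past_martz: "past (Suc n) (martz n)"
  unfolding martz_def by (intro past_mart past_diff past_X past_const)

lemma past_martk: "past (Suc n) (martk n k)"
  unfolding martk_def by (intro past_mart past_diff past_X past_mono[OF past_X])

lemma past_total_noise: "past (Suc n) (total_noise n)"
  unfolding total_noise_def[abs_def] divide_inverse
  by (intro past_add past_sum past_mult past_const past_martz past_martk)

lemma expectation_total_noise: "P.expectation (total_noise n) = 0"
proof -
  have "P.expectation (martz n) = 0" "P.expectation (martk n k) = 0" for k
    unfolding martz_def martk_def
    by (intro expectation_mart past_diff past_X past_const past_mono[OF past_X]; assumption)+
  then show ?thesis unfolding total_noise_def[abs_def]
    by (simp add: past_integrable[OF past_martz] past_integrable[OF past_martk])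
qed

text \<open>\<open>last_le_weighted_average\<close> with weights \<open>rate t\<close>: the full
  average is telescoped against \<open>z\<close>, and each window against its own first
  iterate.\<close>

lemma last_iterate_pathwise:
  assumes \<omega>: "\<omega> \<in> space P"
  shows "\<Phi> (X n \<omega>) - m \<le> gap_bound n - total_noise n \<omega> / rate n"
proof -
  define l N where "l = 1 + ln (real n + 1)" and "N = real n + 1"
  have l: "1 \<le> l" and N: "1 \<le> N" by (auto simp: l_def N_def)
  let ?p = "\<lambda>t. \<Phi> (X t \<omega>) - m"
  have avg: "(\<Sum>t=0..n. rate t * ?p t)
      \<le> ((norm (x0 - z))\<^sup>2 + K\<^sup>2 * \<eta>\<^sup>2 * l) / 2 + 2 * e * \<eta> * sqrt N - martz n \<omega>"
  proof -
    have "(\<Sum>t=0..n. rate t * ?p t)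
        = (\<Sum>t=0..<Suc n. rate t * (\<Phi> (X t \<omega>) - \<Phi> z)) + (\<Phi> z - m) * (\<Sum>t\<le>n. rate t)"
      unfolding atLeastLessThanSuc_atLeastAtMost atMost_atLeast0
      by (simp add: sum_distrib_left sum.distrib[symmetric] algebra_simps)
    \<comment> \<open>The excess is measured from \<open>m\<close>, whereas telescoping measures it
      from \<open>\<Phi> z\<close>; the discrepancy costs at most \<open>e\<close> per unit of
      learning rate.\<close>
    also have "(\<Phi> z - m) * (\<Sum>t\<le>n. rate t) \<le> e * (2 * \<eta> * sqrt N)"
      unfolding N_def
      by (intro mult_mono sum_rate_le sum_nonneg less_imp_le[OF rate_pos])
        (use \<Phi>_z e_nonneg in auto)
    also have "(\<Sum>t=0..<Suc n. rate t * (\<Phi> (X t \<omega>) - \<Phi> z))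
        \<le> (norm (x0 - z))\<^sup>2 / 2 + K\<^sup>2 / 2 * (\<Sum>t\<le>n. (rate t)\<^sup>2) - martz n \<omega>"
      using telescoped[OF \<omega>, of 0 "Suc n" "\<lambda>_. z"] zero_le_power2[of "norm (X (Suc n) \<omega> - z)"]
      unfolding martz_def atLeastLessThanSuc_atLeastAtMost atMost_atLeast0 X.simps(1) diff_divide_distrib
      by linarith
    also have "K\<^sup>2 / 2 * (\<Sum>t\<le>n. (rate t)\<^sup>2) \<le> K\<^sup>2 / 2 * (\<eta>\<^sup>2 * l)"
      unfolding l_def by (intro mult_left_mono sum_rate_sq_le) auto
    finally show ?thesis by (simp add: field_simps)
  qed
  have tail: "(\<Sum>t=n-k..n. rate t * (?p t - ?p (n - k)))
      \<le> K\<^sup>2 * \<eta>\<^sup>2 * l / (2 * N) * real (k + 1) - martk n k \<omega>" if "k \<in> {1..n}" for k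
  proof -
    let ?d = "(norm (X (Suc n) \<omega> - X (n - k) \<omega>))\<^sup>2 / 2"
    \<comment> \<open>The window starts at its comparison point, so no initial distance occurs. The
      final distance has a favourable sign and is dropped afterwards.\<close>
    have "(\<Sum>t=n-k..n. rate t * (?p t - ?p (n - k)))
        \<le> K\<^sup>2 / 2 * (\<Sum>t=n-k..n. (rate t)\<^sup>2) - ?d - martk n k \<omega>"
      using telescoped[OF \<omega>, of "n - k" "Suc n" "X (n - k)", OF le_SucI[OF diff_le_self]]
      unfolding martk_def atLeastLessThanSuc_atLeastAtMost
      by (simp add: diff_divide_distrib del: X.simps)
    also have "\<dots> \<le> K\<^sup>2 / 2 * (\<Sum>t=n-k..n. (rate t)\<^sup>2) - martk n k \<omega>" by simp
    also have "K\<^sup>2 / 2 * (\<Sum>t=n-k..n. (rate t)\<^sup>2) \<le> K\<^sup>2 / 2 * (\<eta>\<^sup>2 * (l * real (k + 1) / N))"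
      using sum_rate_sq_tail_le[of k n] that unfolding l_def N_def
      by (intro mult_left_mono) (auto simp: add_ac)
    finally show ?thesis by (simp add: field_simps)
  qed
  have tails: "(\<Sum>k=1..n. (\<Sum>t=n-k..n. rate t * (?p t - ?p (n - k))) / (real k * real (k + 1)))
      \<le> K\<^sup>2 * \<eta>\<^sup>2 * l\<^sup>2 / (2 * N) - (\<Sum>k=1..n. martk n k \<omega> / (real k * real (k + 1)))"
  proof -
    have "(\<Sum>k=1..n. (\<Sum>t=n-k..n. rate t * (?p t - ?p (n - k))) / (real k * real (k + 1)))
        \<le> (\<Sum>k=1..n. (K\<^sup>2 * \<eta>\<^sup>2 * l / (2 * N) * real (k + 1) - martk n k \<omega>) / (real k * real (k + 1)))"
      by (intro sum_mono divide_right_mono tail) auto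
    \<comment> \<open>The factor \<open>k + 1\<close> cancels against the weight, which leaves a
      harmonic sum and hence a second logarithm.\<close>
    also have "\<dots> = K\<^sup>2 * \<eta>\<^sup>2 * l / (2 * N) * (\<Sum>k=1..n. 1 / real k)
        - (\<Sum>k=1..n. martk n k \<omega> / (real k * real (k + 1)))"
      unfolding sum_distrib_left sum_subtractf[symmetric]
      by (intro sum.cong refl) (simp add: diff_divide_distrib)
    also have "K\<^sup>2 * \<eta>\<^sup>2 * l / (2 * N) * (\<Sum>k=1..n. 1 / real k) \<le> K\<^sup>2 * \<eta>\<^sup>2 * l / (2 * N) * l"
      using l N unfolding l_def by (intro mult_left_mono sum_inverse_Icc_le_ln) auto
    finally show ?thesis by (simp add: power2_eq_square mult.assoc)
  qed
  have tn: "total_noise n \<omega> = martz n \<omega> / N + (\<Sum>k=1..n. martk n k \<omega> / (real k * real (k + 1)))"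
    by (simp add: total_noise_def N_def add_ac)
  have "rate n * ?p n \<le> (\<Sum>t=0..n. rate t * ?p t) / N
      + (\<Sum>k=1..n. (\<Sum>t=n-k..n. rate t * (?p t - ?p (n - k))) / (real k * real (k + 1)))"
    using last_le_weighted_average[OF rate_antimono, of ?p n n] \<Phi>_ge by (simp add: N_def add_ac)
  also have "\<dots> \<le> (((norm (x0 - z))\<^sup>2 + K\<^sup>2 * \<eta>\<^sup>2 * l) / 2 + 2 * e * \<eta> * sqrt N - martz n \<omega>) / N
      + (K\<^sup>2 * \<eta>\<^sup>2 * l\<^sup>2 / (2 * N) - (\<Sum>k=1..n. martk n k \<omega> / (real k * real (k + 1))))"
    using N by (intro add_mono divide_right_mono avg tails) auto
  also have "\<dots> = ((norm (x0 - z))\<^sup>2 + K\<^sup>2 * \<eta>\<^sup>2 * (l + l\<^sup>2)) / (2 * N) + 2 * e * \<eta> * sqrt N / N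
      - total_noise n \<omega>"
    unfolding tn by (simp add: add_divide_distrib diff_divide_distrib distrib_left)
  \<comment> \<open>Since \<open>1 \<le> l\<close>, the single logarithm from the full average is
    absorbed by the squared one from the windows.\<close>
  also have "\<dots> \<le> ((norm (x0 - z))\<^sup>2 + K\<^sup>2 * \<eta>\<^sup>2 * (2 * l\<^sup>2)) / (2 * N) + 2 * e * \<eta> * sqrt N / N
      - total_noise n \<omega>"
    using l N by (intro diff_right_mono add_right_mono divide_right_mono add_left_mono mult_left_mono)
      (auto simp: power2_eq_square)
  also have "\<dots> = rate n * gap_bound n - total_noise n \<omega>"
  proof -
    have "N = sqrt N * sqrt N" using N by simp
    moreover have "rate n = \<eta> / sqrt N" by (simp add: rate_def N_def add_ac)
    moreover have "gap_bound n = ((norm (x0 - z))\<^sup>2 / \<eta> + 2 * K\<^sup>2 * \<eta> * l\<^sup>2) / (2 * sqrt N) + 2 * e"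
      by (simp add: gap_rate_def l_def N_def)
    moreover have "0 < sqrt N" using N by simp
    moreover have "(a + K\<^sup>2 * \<eta>\<^sup>2 * (2 * l\<^sup>2)) / (2 * (q * q)) + 2 * e * \<eta> * q / (q * q)
      = \<eta> / q * ((a / \<eta> + 2 * K\<^sup>2 * \<eta> * l\<^sup>2) / (2 * q) + 2 * e)" if "0 < q" for q a
      using that \<eta>_pos by (simp add: field_simps power2_eq_square)
    ultimately show ?thesis by metis
  qed
  finally show ?thesis using rate_pos[of n] by (simp add: field_simps)
qed

text \<open>The noise has mean zero, so only the deterministic bound survives in the mean.\<close>

lemma expectation_gap_le: "P.expectation (\<lambda>\<omega>. \<Phi> (X n \<omega>) - m) \<le> gap_bound n"
proof -
  have "P.expectation (\<lambda>\<omega>. \<Phi> (X n \<omega>) - m)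
      \<le> P.expectation (\<lambda>\<omega>. gap_bound n - total_noise n \<omega> / rate n)"
    by (intro integral_mono last_iterate_pathwise past_integrable[of "Suc n"])
      (auto intro!: past_diff past_const past_\<Phi> past_mono[OF past_X] past_mult past_total_noise
        simp: divide_inverse)
  also have "\<dots> = gap_bound n"
    by (simp add: past_integrable[OF past_total_noise] expectation_total_noise P.prob_space)
  finally show ?thesis .
qed

end

section \<open>Second moment of the noise\<close>

text \<open>An upper bound for the second moment of the quotient of \<open>total_noise n\<close> by
  \<open>rate n\<close>, again as a function of real parameters.\<close>

definition noise_rate :: "real \<Rightarrow> real \<Rightarrow> real \<Rightarrow> real \<Rightarrow> nat \<Rightarrow> real" where
  "noise_rate R K \<eta> e n = 8 * K\<^sup>2 * (1 + ln (real n + 1)) ^ 3 *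
     ((3 * R\<^sup>2 + 7 * K\<^sup>2 * \<eta>\<^sup>2 * (1 + ln (real n + 1))\<^sup>2) / (real n + 1)
      + 12 * e * \<eta> / sqrt (real n + 1))"

context sgd_process
begin

text \<open>The coefficient of \<open>1 / (s + 1)\<close> in the estimate of the mean squared
  displacement since time \<open>s\<close>.\<close>

definition near_bound :: "nat \<Rightarrow> real" where
  "near_bound n = (norm (x0 - z))\<^sup>2 + K\<^sup>2 * \<eta>\<^sup>2 + 2 * K\<^sup>2 * \<eta>\<^sup>2 * (1 + ln (real n + 1))\<^sup>2"

text \<open>Controls the mean squared distance from \<open>z\<close> at all times up to
  \<open>n\<close>.\<close>

definition far_bound :: "nat \<Rightarrow> real" where
  "far_bound n = (norm (x0 - z))\<^sup>2 + K\<^sup>2 * \<eta>\<^sup>2 * (1 + ln (real n + 1)) + 4 * e * \<eta> * sqrt (real n + 1)"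

text \<open>\<open>telescoped\<close> solved for the final distance instead of the values of
  \<open>\<Phi>\<close>. The martingale term disappears in the mean, and \<open>b\<close> limits by
  how much later values can fall below the value at \<open>y\<close>.\<close>

lemma expectation_dist_sq_le:
  assumes y: "past s y" and st: "s \<le> t"
    and b: "\<And>r. r \<in> {s..<t} \<Longrightarrow> P.expectation (\<lambda>\<omega>. \<Phi> (y \<omega>) - \<Phi> (X r \<omega>)) \<le> b"
  shows "P.expectation (\<lambda>\<omega>. (norm (X t \<omega> - y \<omega>))\<^sup>2)
    \<le> P.expectation (\<lambda>\<omega>. (norm (X s \<omega> - y \<omega>))\<^sup>2) + K\<^sup>2 * (\<Sum>r=s..<t. (rate r)\<^sup>2) + 2 * (\<Sum>r=s..<t. rate r) * b"
proof -
  let ?M = "mart s t (\<lambda>t \<omega>. X t \<omega> - y \<omega>)"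
  let ?q = "\<lambda>r \<omega>. \<Phi> (y \<omega>) - \<Phi> (X r \<omega>)"
  let ?a = "\<lambda>r \<omega>. (norm (X r \<omega> - y \<omega>))\<^sup>2"
  let ?c = "K\<^sup>2 * (\<Sum>r=s..<t. (rate r)\<^sup>2)"
  have y': "past r y" if "s \<le> r" for r using y that by (rule past_mono)
  have pM: "past t ?M" by (intro past_mart past_diff past_X y')
  have pq: "past t (?q r)" if "r \<in> {s..<t}" for r
    using that st by (intro past_diff past_\<Phi> y' past_mono[OF past_X]) auto
  have pa: "past t (?a r)" if "r \<in> {s..t}" for r
    using that st by (intro past_norm_sq past_diff y' past_mono[OF past_X]) auto
  have psum: "past t (\<lambda>\<omega>. \<Sum>r=s..<t. 2 * rate r * ?q r \<omega>)"
    by (intro past_sum past_mult past_const pq)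
  have "P.expectation (?a t)
      \<le> P.expectation (\<lambda>\<omega>. ((?a s \<omega> + ?c) - 2 * ?M \<omega>) + (\<Sum>r=s..<t. 2 * rate r * ?q r \<omega>))"
  proof (rule integral_mono)
    fix \<omega> assume \<omega>: "\<omega> \<in> space P"
    have "(\<Sum>r=s..<t. 2 * rate r * ?q r \<omega>) = - 2 * (\<Sum>r=s..<t. rate r * (\<Phi> (X r \<omega>) - \<Phi> (y \<omega>)))"
      unfolding sum_distrib_left by (rule sum.cong) (auto simp: algebra_simps)
    then show "?a t \<omega> \<le> ((?a s \<omega> + ?c) - 2 * ?M \<omega>) + (\<Sum>r=s..<t. 2 * rate r * ?q r \<omega>)"
      using telescoped[OF \<omega> st, of y] by (simp add: diff_divide_distrib)
  qed (use st in \<open>intro past_integrable[of t] past_add past_diff past_const past_mult psum pM pa; simp\<close>)+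
  also have "\<dots> = P.expectation (?a s) + ?c + (\<Sum>r=s..<t. 2 * rate r * P.expectation (?q r))"
  proof -
    have iq: "integrable P (\<lambda>\<omega>. 2 * rate r * ?q r \<omega>)" if "r \<in> {s..<t}" for r
      using past_integrable[OF past_mult[OF past_const pq[OF that]]] .
    have "P.expectation ?M = 0" by (intro expectation_mart past_diff past_X y')
    moreover have "P.expectation (\<lambda>\<omega>. \<Sum>r=s..<t. 2 * rate r * ?q r \<omega>)
        = (\<Sum>r=s..<t. 2 * rate r * P.expectation (?q r))"
      using iq by (subst Bochner_Integration.integral_sum) auto
    ultimately show ?thesis
      using past_integrable[OF pM] past_integrable[OF pa, of s] past_integrable[OF psum] st
      by (simp add: P.prob_space)
  qed
  also have "(\<Sum>r=s..<t. 2 * rate r * P.expectation (?q r)) \<le> (\<Sum>r=s..<t. 2 * rate r * b)"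
    using rate_pos by (intro sum_mono mult_left_mono b) (auto intro: less_imp_le)
  also have "\<dots> = 2 * (\<Sum>r=s..<t. rate r) * b"
    by (simp add: sum_distrib_left sum_distrib_right)
  finally show ?thesis by simp
qed

text \<open>From time \<open>s\<close> on the rates are at most \<open>rate s\<close>, and in the
  mean \<open>\<Phi>\<close> can fall below its value at \<open>X s\<close> by no more than the
  expected excess at time \<open>s\<close>.\<close>

lemma near_dist:
  assumes "s \<le> t" "t \<le> n"
  shows "P.expectation (\<lambda>\<omega>. (norm (X t \<omega> - X s \<omega>))\<^sup>2)
    \<le> real (n - s) * (near_bound n / real (s + 1) + 4 * e * \<eta> / sqrt (real (s + 1)))"
proof -
  \<comment> \<open>The logarithm is taken at \<open>n\<close> instead of \<open>s\<close>, so that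
    one coefficient serves every starting time.\<close>
  define l q where "l = 1 + ln (real n + 1)" and "q = sqrt (real (s + 1))"
  have q: "0 < q" "real (s + 1) = q * q" by (auto simp: q_def)
  have ls: "(1 + ln (real s + 1))\<^sup>2 \<le> l\<^sup>2" unfolding l_def using assms by (intro power_mono) auto
  have *: "2 * K\<^sup>2 * \<eta> * (1 + ln (real s + 1))\<^sup>2 \<le> 2 * K\<^sup>2 * \<eta> * l\<^sup>2"
    using \<eta>_pos by (intro mult_left_mono ls) auto
  have gs: "gap_bound s \<le> ((norm (x0 - z))\<^sup>2 / \<eta> + 2 * K\<^sup>2 * \<eta> * l\<^sup>2) / (2 * q) + 2 * e" (is "_ \<le> ?b")
  proof -
    have "sqrt (real s + 1) = q" by (simp add: q_def add_ac)
    with * q(1) show ?thesis unfolding gap_rate_def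
      by (intro add_mono) (auto intro!: divide_right_mono)
  qed
  have b0: "0 \<le> ?b" using \<eta>_pos q e_nonneg by (intro add_nonneg_nonneg divide_nonneg_pos) auto
  have rs: "rate s = \<eta> / q" by (simp add: rate_def q_def add_ac)
  have "P.expectation (\<lambda>\<omega>. (norm (X t \<omega> - X s \<omega>))\<^sup>2)
      \<le> P.expectation (\<lambda>\<omega>. (norm (X s \<omega> - X s \<omega>))\<^sup>2) + K\<^sup>2 * (\<Sum>r=s..<t. (rate r)\<^sup>2) + 2 * (\<Sum>r=s..<t. rate r) * ?b"
  proof (intro expectation_dist_sq_le past_X assms(1))
    fix r assume r: "r \<in> {s..<t}"
    have "P.expectation (\<lambda>\<omega>. \<Phi> (X s \<omega>) - \<Phi> (X r \<omega>)) \<le> P.expectation (\<lambda>\<omega>. \<Phi> (X s \<omega>) - m)"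
      using \<Phi>_ge by (intro integral_mono past_integrable[of r] past_diff past_\<Phi> past_const past_mono[OF past_X])
        (use r in auto)
    also have "\<dots> \<le> ?b" using expectation_gap_le[of s] gs by simp
    finally show "P.expectation (\<lambda>\<omega>. \<Phi> (X s \<omega>) - \<Phi> (X r \<omega>)) \<le> ?b" .
  qed
  also have "\<dots> = K\<^sup>2 * (\<Sum>r=s..<t. (rate r)\<^sup>2) + 2 * (\<Sum>r=s..<t. rate r) * ?b" by simp
  also have "\<dots> \<le> K\<^sup>2 * (real (t - s) * (rate s)\<^sup>2) + 2 * (real (t - s) * rate s) * ?b"
  proof -
    have "(\<Sum>r=s..<t. (rate r)\<^sup>2) \<le> (\<Sum>r=s..<t. (rate s)\<^sup>2)"
      by (intro sum_mono power_mono antimonoD[OF rate_antimono]) (auto intro: less_imp_le[OF rate_pos])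
    moreover have "(\<Sum>r=s..<t. rate r) \<le> (\<Sum>r=s..<t. rate s)"
      by (intro sum_mono antimonoD[OF rate_antimono]) auto
    ultimately show ?thesis using b0 by (intro add_mono mult_left_mono mult_right_mono) auto
  qed
  also have "\<dots> = real (t - s) * (near_bound n / (q * q) + 4 * e * \<eta> / q)"
  proof -
    have "K\<^sup>2 * (d * (\<eta> / q)\<^sup>2) + 2 * (d * (\<eta> / q)) * ((a / \<eta> + 2 * K\<^sup>2 * \<eta> * l\<^sup>2) / (2 * q) + 2 * e)
      = d * ((a + K\<^sup>2 * \<eta>\<^sup>2 + 2 * K\<^sup>2 * \<eta>\<^sup>2 * l\<^sup>2) / (q * q) + 4 * e * \<eta> / q)" for d a
      using q \<eta>_pos by (simp add: field_simps power2_eq_square)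
    then show ?thesis unfolding rs near_bound_def l_def by simp
  qed
  also have "\<dots> \<le> real (n - s) * (near_bound n / (q * q) + 4 * e * \<eta> / q)"
    using assms q \<eta>_pos e_nonneg by (intro mult_right_mono) (auto simp: near_bound_def)
  finally show ?thesis unfolding q(2)[symmetric] q_def by simp
qed

text \<open>The same estimate with the constant comparison point \<open>z\<close>, whose value
  exceeds any other by at most \<open>e\<close>.\<close>

lemma far_dist:
  assumes "t \<le> n"
  shows "P.expectation (\<lambda>\<omega>. (norm (X t \<omega> - z))\<^sup>2) \<le> far_bound n"
proof -
  have "P.expectation (\<lambda>\<omega>. (norm (X t \<omega> - z))\<^sup>2)
      \<le> P.expectation (\<lambda>\<omega>. (norm (X 0 \<omega> - z))\<^sup>2) + K\<^sup>2 * (\<Sum>r=0..<t. (rate r)\<^sup>2) + 2 * (\<Sum>r=0..<t. rate r) * e"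
  proof (intro expectation_dist_sq_le past_const)
    fix r
    have "P.expectation (\<lambda>\<omega>. \<Phi> z - \<Phi> (X r \<omega>)) \<le> P.expectation (\<lambda>\<omega>. e)"
    proof (intro integral_mono past_integrable[of r] past_diff past_\<Phi> past_const past_X)
      show "\<Phi> z - \<Phi> (X r \<omega>) \<le> e" for \<omega> using \<Phi>_z \<Phi>_ge[of "X r \<omega>"] by simp
    qed
    then show "P.expectation (\<lambda>\<omega>. \<Phi> z - \<Phi> (X r \<omega>)) \<le> e" by (simp add: P.prob_space)
  qed simp
  also have "(\<Sum>r=0..<t. (rate r)\<^sup>2) \<le> (\<Sum>r\<le>n. (rate r)\<^sup>2)"
    using assms by (intro sum_mono2) auto
  also have "\<dots> \<le> \<eta>\<^sup>2 * (1 + ln (real n + 1))" by (rule sum_rate_sq_le)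
  also have "(\<Sum>r=0..<t. rate r) \<le> (\<Sum>r\<le>n. rate r)"
    using assms by (intro sum_mono2) (auto intro: less_imp_le[OF rate_pos])
  also have "\<dots> \<le> 2 * \<eta> * sqrt (real n + 1)" by (rule sum_rate_le)
  finally show ?thesis using e_nonneg
    by (simp add: far_bound_def P.prob_space mult_left_mono mult_right_mono algebra_simps)
qed

lemma martz_sq:
  "P.expectation (\<lambda>\<omega>. (martz n \<omega>)\<^sup>2) \<le> 4 * K\<^sup>2 * (\<eta>\<^sup>2 * (1 + ln (real n + 1)) * far_bound n)"
proof -
  have "P.expectation (\<lambda>\<omega>. (martz n \<omega>)\<^sup>2)
      \<le> 4 * K\<^sup>2 * (\<Sum>t=0..<Suc n. (rate t)\<^sup>2 * P.expectation (\<lambda>\<omega>. (norm (X t \<omega> - z))\<^sup>2))"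
    unfolding martz_def by (intro expectation_mart_sq_le past_diff past_X past_const)
  also have "\<dots> \<le> 4 * K\<^sup>2 * (\<Sum>t=0..<Suc n. (rate t)\<^sup>2 * far_bound n)"
    by (intro mult_left_mono sum_mono far_dist) auto
  also have "\<dots> = 4 * K\<^sup>2 * ((\<Sum>t\<le>n. (rate t)\<^sup>2) * far_bound n)"
    by (simp only: sum_distrib_right atLeastLessThanSuc_atLeastAtMost atMost_atLeast0)
  also have "\<dots> \<le> 4 * K\<^sup>2 * (\<eta>\<^sup>2 * (1 + ln (real n + 1)) * far_bound n)"
    using e_nonneg \<eta>_pos
    by (intro mult_left_mono mult_right_mono sum_rate_sq_le) (auto simp: far_bound_def)
  finally show ?thesis .
qed

text \<open>All iterates of the window lie at most \<open>k\<close> steps after its start, which is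
  the source of the factor \<open>k\<close> supplied by \<open>near_dist\<close>.\<close>

lemma martk_sq:
  assumes "k \<le> n"
  shows "P.expectation (\<lambda>\<omega>. (martk n k \<omega>)\<^sup>2) \<le> 4 * K\<^sup>2 *
    (\<eta>\<^sup>2 * ((1 + ln (real n + 1)) * real (k + 1) / real (n + 1)) *
     (real k * (near_bound n / real (n - k + 1) + 4 * e * \<eta> / sqrt (real (n - k + 1)))))" (is "_ \<le> 4 * K\<^sup>2 * (_ * ?d)")
proof -
  have "P.expectation (\<lambda>\<omega>. (martk n k \<omega>)\<^sup>2)
      \<le> 4 * K\<^sup>2 * (\<Sum>t=n-k..<Suc n. (rate t)\<^sup>2 * P.expectation (\<lambda>\<omega>. (norm (X t \<omega> - X (n - k) \<omega>))\<^sup>2))"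
    unfolding martk_def by (intro expectation_mart_sq_le past_diff past_X past_mono[OF past_X])
  also have "\<dots> \<le> 4 * K\<^sup>2 * (\<Sum>t=n-k..<Suc n. (rate t)\<^sup>2 * ?d)"
  proof (intro mult_left_mono sum_mono)
    fix t assume "t \<in> {n-k..<Suc n}"
    then show "P.expectation (\<lambda>\<omega>. (norm (X t \<omega> - X (n - k) \<omega>))\<^sup>2) \<le> ?d"
      using near_dist[of "n - k" t n] assms by simp
  qed auto
  also have "\<dots> = 4 * K\<^sup>2 * ((\<Sum>t=n-k..n. (rate t)\<^sup>2) * ?d)"
    by (simp only: sum_distrib_right atLeastLessThanSuc_atLeastAtMost)
  also have "\<dots> \<le> 4 * K\<^sup>2 * (\<eta>\<^sup>2 * ((1 + ln (real n + 1)) * real (k + 1) / real (n + 1)) * ?d)"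
    using e_nonneg \<eta>_pos
    by (intro mult_left_mono mult_right_mono sum_rate_sq_tail_le assms mult_nonneg_nonneg add_nonneg_nonneg divide_nonneg_nonneg)
      (auto simp: near_bound_def)
  finally show ?thesis .
qed

abbreviation "noise_bound_sq \<equiv> noise_rate (norm (x0 - z)) K \<eta> e"

text \<open>\<open>weighted_sum_sq_le\<close> separates the windows. The bound for window
  \<open>k\<close> carries a factor \<open>k * (k + 1)\<close>, which cancels most of the weight and
  leaves the sums of \<open>1 / (k * (n - k + 1))\<close> and of its square root analogue.\<close>

lemma expectation_total_noise_sq_le:
  "P.expectation (\<lambda>\<omega>. (total_noise n \<omega>)\<^sup>2) \<le> (rate n)\<^sup>2 * noise_bound_sq n"
proof -
  define l N q where "l = 1 + ln (real n + 1)" and "N = real n + 1" and "q = sqrt N"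
  have l: "1 \<le> l" and N: "1 \<le> N" by (auto simp: l_def N_def)
  have q: "0 < q" "N = q * q" "1 \<le> q" using N by (auto simp: q_def)
  define B1 B2 B3 where "B1 = near_bound n" and "B2 = 4 * e * \<eta>" and "B3 = far_bound n"
  have B: "0 \<le> B1" "0 \<le> B2" "0 \<le> B3" using e_nonneg \<eta>_pos
    by (auto simp: B1_def B2_def B3_def near_bound_def far_bound_def)
  let ?k = "\<lambda>k \<omega>. (martk n k \<omega>)\<^sup>2 / (real k * (real (k + 1))\<^sup>2)"
  have pk: "past (Suc n) (\<lambda>\<omega>. (martk n k \<omega>)\<^sup>2)" and pz: "past (Suc n) (\<lambda>\<omega>. (martz n \<omega>)\<^sup>2)"
    and pt: "past (Suc n) (\<lambda>\<omega>. (total_noise n \<omega>)\<^sup>2)" for k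
    unfolding power2_eq_square by (intro past_mult past_martk past_martz past_total_noise)+
  have psum: "past (Suc n) (\<lambda>\<omega>. \<Sum>k=1..n. ?k k \<omega>)"
    unfolding divide_inverse by (intro past_sum past_mult past_const pk)
  have "P.expectation (\<lambda>\<omega>. (total_noise n \<omega>)\<^sup>2)
      \<le> P.expectation (\<lambda>\<omega>. 2 / N\<^sup>2 * (martz n \<omega>)\<^sup>2 + 2 * l * (\<Sum>k=1..n. ?k k \<omega>))"
  proof (rule integral_mono)
    fix \<omega>
    let ?a = "martz n \<omega> / N" and ?b = "\<Sum>k=1..n. martk n k \<omega> / (real k * real (k + 1))"
    have "(?a + ?b)\<^sup>2 \<le> 2 * ?a\<^sup>2 + 2 * ?b\<^sup>2"
      using zero_le_power2[of "?a - ?b"] by (simp only: power2_sum power2_diff)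
    also have "?b\<^sup>2 \<le> l * (\<Sum>k=1..n. ?k k \<omega>)" unfolding l_def by (rule weighted_sum_sq_le)
    finally show "(total_noise n \<omega>)\<^sup>2 \<le> 2 / N\<^sup>2 * (martz n \<omega>)\<^sup>2 + 2 * l * (\<Sum>k=1..n. ?k k \<omega>)"
      by (simp add: total_noise_def N_def power_divide add_ac)
  qed (intro past_integrable[of "Suc n"] past_add past_mult past_const pz psum pt)+
  also have "\<dots> = 2 / N\<^sup>2 * P.expectation (\<lambda>\<omega>. (martz n \<omega>)\<^sup>2)
      + 2 * l * (\<Sum>k=1..n. P.expectation (\<lambda>\<omega>. (martk n k \<omega>)\<^sup>2) / (real k * (real (k + 1))\<^sup>2))"
    using past_integrable[OF pz] past_integrable[OF psum] past_integrable[OF pk]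
    by (simp add: Bochner_Integration.integral_sum)
  also have "\<dots> \<le> 2 / N\<^sup>2 * (4 * K\<^sup>2 * (\<eta>\<^sup>2 * l * B3))
      + 2 * l * (\<Sum>k=1..n. 4 * K\<^sup>2 * \<eta>\<^sup>2 * l / N
          * (B1 * (1 / (real k * real (n - k + 1))) + B2 * (1 / (real k * sqrt (real (n - k + 1))))))"
  proof (intro add_mono mult_left_mono sum_mono)
    show "P.expectation (\<lambda>\<omega>. (martz n \<omega>)\<^sup>2) \<le> 4 * K\<^sup>2 * (\<eta>\<^sup>2 * l * B3)"
      unfolding l_def B3_def by (rule martz_sq)
    fix k assume k: "k \<in> {1..n}"
    let ?D = "B1 / real (n - k + 1) + B2 / sqrt (real (n - k + 1))"
    have D: "0 \<le> ?D" using B by (intro add_nonneg_nonneg divide_nonneg_nonneg) auto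
    have "P.expectation (\<lambda>\<omega>. (martk n k \<omega>)\<^sup>2) \<le> 4 * K\<^sup>2 * (\<eta>\<^sup>2 * (l * real (k + 1) / N) * (real k * ?D))"
      using martk_sq[of k n] k by (simp add: l_def N_def B1_def B2_def add_ac)
    then have "P.expectation (\<lambda>\<omega>. (martk n k \<omega>)\<^sup>2) / (real k * (real (k + 1))\<^sup>2)
        \<le> 4 * K\<^sup>2 * (\<eta>\<^sup>2 * (l * real (k + 1) / N) * (real k * ?D)) / (real k * (real (k + 1))\<^sup>2)"
      by (rule divide_right_mono) auto
    also have "\<dots> = 4 * K\<^sup>2 * \<eta>\<^sup>2 * l / N * (?D / real (k + 1))"
    proof -
      have "4 * K\<^sup>2 * (\<eta>\<^sup>2 * (l * b / N) * (a * d)) / (a * b\<^sup>2) = 4 * K\<^sup>2 * \<eta>\<^sup>2 * l / N * (d / b)"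
        if "0 < a" "0 < b" for a b d :: real
        using that N by (simp add: field_simps power2_eq_square)
      from this[of "real k" "real (k + 1)" ?D] k show ?thesis by (simp only: of_nat_0_less_iff) auto
    qed
    \<comment> \<open>\<open>1 / (k + 1)\<close> is weakened to \<open>1 / k\<close> to match the
      sums computed by partial fractions.\<close>
    also have "\<dots> \<le> 4 * K\<^sup>2 * \<eta>\<^sup>2 * l / N * (?D / real k)"
      using k l N D by (intro mult_left_mono divide_left_mono) auto
    also have "?D / real k = B1 * (1 / (real k * real (n - k + 1))) + B2 * (1 / (real k * sqrt (real (n - k + 1))))"
      by (simp add: add_divide_distrib mult.commute)
    finally show "P.expectation (\<lambda>\<omega>. (martk n k \<omega>)\<^sup>2) / (real k * (real (k + 1))\<^sup>2)
      \<le> 4 * K\<^sup>2 * \<eta>\<^sup>2 * l / N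
          * (B1 * (1 / (real k * real (n - k + 1))) + B2 * (1 / (real k * sqrt (real (n - k + 1)))))" .
  qed (use l N in auto)
  also have "\<dots> = 2 / N\<^sup>2 * (4 * K\<^sup>2 * (\<eta>\<^sup>2 * l * B3))
      + 2 * l * (4 * K\<^sup>2 * \<eta>\<^sup>2 * l / N
          * (B1 * (\<Sum>k=1..n. 1 / (real k * real (n - k + 1)))
            + B2 * (\<Sum>k=1..n. 1 / (real k * sqrt (real (n - k + 1))))))"
    by (simp only: sum_distrib_left[symmetric] sum.distrib)
  also have "\<dots> \<le> 2 / N\<^sup>2 * (4 * K\<^sup>2 * (\<eta>\<^sup>2 * l * B3))
      + 2 * l * (4 * K\<^sup>2 * \<eta>\<^sup>2 * l / N * (B1 * (2 * l / N) + B2 * (2 * l / q)))"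
    unfolding l_def N_def q_def
    by (intro add_left_mono mult_left_mono add_mono sum_inverse_prod_le sum_inverse_prod_sqrt_le)
      (use B in auto)
  also have "\<dots> = 8 * K\<^sup>2 * \<eta>\<^sup>2 / N * (l * B3 / N + l ^ 3 * (2 * B1 / N + 2 * B2 / q))"
    using N q(1) by (simp add: field_simps power2_eq_square power3_eq_cube)
  \<comment> \<open>The lone logarithm is raised to the third power so that both contributions share
    one factor.\<close>
  also have "\<dots> \<le> 8 * K\<^sup>2 * \<eta>\<^sup>2 / N * (l ^ 3 * B3 / N + l ^ 3 * (2 * B1 / N + 2 * B2 / q))"
    using l N B power_increasing[of 1 3 l]
    by (intro mult_left_mono add_right_mono divide_right_mono mult_right_mono) auto
  also have "\<dots> = 8 * K\<^sup>2 * \<eta>\<^sup>2 / N * (l ^ 3 * ((B3 + 2 * B1) / N + 2 * B2 / q))"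
    by (simp add: algebra_simps add_divide_distrib)
  also have "\<dots> \<le> 8 * K\<^sup>2 * \<eta>\<^sup>2 / N * (l ^ 3 *
      ((3 * (norm (x0 - z))\<^sup>2 + 7 * K\<^sup>2 * \<eta>\<^sup>2 * l\<^sup>2 + B2 * q) / N + 2 * B2 / q))"
  proof -
    \<comment> \<open>The coefficient 3 counts the initial distance once in \<open>B3\<close> and
      twice in \<open>2 * B1\<close>. After 1 and \<open>l\<close> are replaced by
      \<open>l^2\<close>, the other terms without \<open>e\<close> add up to 7 = 1 + 2 + 4.\<close>
    have "K\<^sup>2 * \<eta>\<^sup>2 * l \<le> K\<^sup>2 * \<eta>\<^sup>2 * l\<^sup>2" "K\<^sup>2 * \<eta>\<^sup>2 * 1 \<le> K\<^sup>2 * \<eta>\<^sup>2 * l\<^sup>2"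
      using self_le_power[OF l, of 2] one_le_power[OF l, of 2] by (intro mult_left_mono; simp)+
    then have "B3 + 2 * B1 \<le> 3 * (norm (x0 - z))\<^sup>2 + 7 * K\<^sup>2 * \<eta>\<^sup>2 * l\<^sup>2 + B2 * q"
      by (simp add: B3_def B1_def B2_def far_bound_def near_bound_def l_def N_def q_def)
    then show ?thesis using l N by (intro mult_left_mono add_right_mono divide_right_mono) auto
  qed
  also have "\<dots> = (rate n)\<^sup>2 * noise_bound_sq n"
  proof -
    have "rate n = \<eta> / q" by (simp add: rate_def q_def N_def add_ac)
    then have r: "(rate n)\<^sup>2 = \<eta>\<^sup>2 / N" using q by (simp add: power_divide power2_eq_square)
    \<comment> \<open>The 12 is three times the 4 in \<open>B2\<close>: one share comes from
      \<open>far_bound\<close>, two from the windows.\<close>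
    have "(a + B2 * q) / N + 2 * B2 / q = a / N + 12 * e * \<eta> / q" for a
      unfolding q(2) B2_def using q(1) by (simp add: field_simps)
    moreover have "noise_bound_sq n = 8 * K\<^sup>2 * l ^ 3 *
        ((3 * (norm (x0 - z))\<^sup>2 + 7 * K\<^sup>2 * \<eta>\<^sup>2 * l\<^sup>2) / N + 12 * e * \<eta> / q)"
      by (simp add: noise_rate_def l_def N_def q_def)
    ultimately show ?thesis unfolding r by simp
  qed
  finally show ?thesis .
qed

text \<open>Chebyshev's inequality for the quotient of \<open>total_noise n\<close> by
  \<open>rate n\<close>, which has mean zero; off the exceptional event the pathwise bound
  applies.\<close>

theorem last_iterate_high_probability:
  assumes "0 < a"
  shows "P.prob {\<omega> \<in> space P. \<Phi> (X n \<omega>) \<le> m + gap_bound n + a} \<ge> 1 - noise_bound_sq n / a\<^sup>2"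
proof -
  let ?Z = "\<lambda>\<omega>. inverse (rate n) * total_noise n \<omega>"
  have pZ: "past (Suc n) ?Z" by (intro past_mult past_const past_total_noise)
  have [measurable]: "?Z \<in> borel_measurable P" by (rule past_measurable[OF pZ])
  have [measurable]: "X n \<in> borel_measurable P" by (rule past_measurable[OF past_X])
  have int: "integrable P (\<lambda>\<omega>. (?Z \<omega>)\<^sup>2)"
    unfolding power2_eq_square by (rule past_integrable[OF past_mult[OF pZ pZ]])
  have EZ: "P.expectation ?Z = 0" by (simp add: expectation_total_noise)
  have "P.expectation (\<lambda>\<omega>. (?Z \<omega>)\<^sup>2) = (inverse (rate n))\<^sup>2 * P.expectation (\<lambda>\<omega>. (total_noise n \<omega>)\<^sup>2)"
    by (simp add: power_mult_distrib)
  also have "\<dots> \<le> (inverse (rate n))\<^sup>2 * ((rate n)\<^sup>2 * noise_bound_sq n)"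
    by (intro mult_left_mono expectation_total_noise_sq_le) auto
  also have "\<dots> = noise_bound_sq n" using rate_pos[of n] by (simp add: field_simps)
  finally have V: "P.expectation (\<lambda>\<omega>. (?Z \<omega>)\<^sup>2) \<le> noise_bound_sq n" .
  have "P.prob {\<omega>\<in>space P. a \<le> \<bar>?Z \<omega>\<bar>} \<le> P.expectation (\<lambda>\<omega>. (?Z \<omega>)\<^sup>2) / a\<^sup>2"
    using P.Chebyshev_inequality[OF _ int assms] unfolding EZ by simp
  also have "\<dots> \<le> noise_bound_sq n / a\<^sup>2" by (intro divide_right_mono V) simp
  finally have "1 - noise_bound_sq n / a\<^sup>2 \<le> 1 - P.prob {\<omega>\<in>space P. a \<le> \<bar>?Z \<omega>\<bar>}" by simp
  also have "\<dots> = P.prob (space P - {\<omega>\<in>space P. a \<le> \<bar>?Z \<omega>\<bar>})"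
    by (rule P.prob_compl[symmetric]) measurable
  also have "\<dots> \<le> P.prob {\<omega> \<in> space P. \<Phi> (X n \<omega>) \<le> m + gap_bound n + a}"
  proof (rule P.finite_measure_mono)
    show "{\<omega> \<in> space P. \<Phi> (X n \<omega>) \<le> m + gap_bound n + a} \<in> P.events" by measurable
    show "space P - {\<omega>\<in>space P. a \<le> \<bar>?Z \<omega>\<bar>} \<subseteq> {\<omega> \<in> space P. \<Phi> (X n \<omega>) \<le> m + gap_bound n + a}"
    proof
      fix \<omega> assume "\<omega> \<in> space P - {\<omega>\<in>space P. a \<le> \<bar>?Z \<omega>\<bar>}"
      then have \<omega>: "\<omega> \<in> space P" and "\<bar>?Z \<omega>\<bar> < a" by auto
      then have "- (total_noise n \<omega> / rate n) < a" by (simp add: divide_inverse mult.commute abs_less_iff)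
      then show "\<omega> \<in> {\<omega> \<in> space P. \<Phi> (X n \<omega>) \<le> m + gap_bound n + a}"
        using last_iterate_pathwise[OF \<omega>, of n] \<omega> by simp
    qed
  qed
  finally show ?thesis .
qed

text \<open>Serves to pass from the excess of \<open>\<Phi>\<close> to a smaller quantity
  \<open>q\<close>, namely the excess of \<open>f\<close> at the projected point.\<close>

corollary last_iterate_high_probability_le:
  assumes "0 < a" and [measurable]: "q \<in> borel_measurable borel" and q: "\<And>x. q x \<le> \<Phi> x - m"
    and b: "gap_bound n + a \<le> b"
  shows "P.prob {\<omega> \<in> space P. q (X n \<omega>) \<le> b} \<ge> 1 - noise_bound_sq n / a\<^sup>2"
proof -
  have [measurable]: "X n \<in> borel_measurable P" by (rule past_measurable[OF past_X])
  have "1 - noise_bound_sq n / a\<^sup>2 \<le> P.prob {\<omega> \<in> space P. \<Phi> (X n \<omega>) \<le> m + gap_bound n + a}"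
    by (rule last_iterate_high_probability[OF assms(1)])
  also have "\<dots> \<le> P.prob {\<omega> \<in> space P. q (X n \<omega>) \<le> b}"
  proof (rule P.finite_measure_mono)
    show "{\<omega> \<in> space P. \<Phi> (X n \<omega>) \<le> m + gap_bound n + a} \<subseteq> {\<omega> \<in> space P. q (X n \<omega>) \<le> b}"
    proof safe
      fix \<omega> assume "\<Phi> (X n \<omega>) \<le> m + gap_bound n + a"
      then show "q (X n \<omega>) \<le> b" using q[of "X n \<omega>"] b by linarith
    qed
  qed measurable
  finally show ?thesis .
qed

end

section \<open>Penalization and smoothing\<close>

lemma is_subgrad_add:
  "is_subgrad h x a \<Longrightarrow> is_subgrad k x b \<Longrightarrow> is_subgrad (\<lambda>x. h x + k x) x (a + b)"
  unfolding is_subgrad_def inner_add_left by (smt (verit))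

lemma is_subgrad_mult:
  assumes "0 \<le> c" "is_subgrad h x a" shows "is_subgrad (\<lambda>x. c * h x) x (c *\<^sub>R a)"
  using assms mult_left_mono[OF _ assms(1)] unfolding is_subgrad_def
  by (auto simp: distrib_left[symmetric])

section \<open>The penalization function and the distance to C\<close>

context
  fixes C :: "'a::euclidean_space set"
  assumes C: "compact C" "convex C" "C \<noteq> {}"
begin

text \<open>From an interior point a small move towards \<open>y\<close> stays in \<open>C\<close>,
  which contradicts the obtuse angle between \<open>y - p\<close> and every direction into
  \<open>C\<close>.\<close>

lemma closest_point_frontier:
  assumes "y \<notin> C" shows "closest_point C y \<in> frontier C"
proof -
  define p where "p = closest_point C y"
  have closed: "closed C" using C by (simp add: compact_imp_closed)
  have p: "p \<in> C" unfolding p_def using closed C by (intro closest_point_in_set)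
  have "p \<notin> interior C"
  proof
    assume "p \<in> interior C"
    then obtain r where r: "0 < r" "ball p r \<subseteq> C" by (auto simp: mem_interior)
    \<comment> \<open>The added 1 keeps the denominator positive; the displacement is then at most
      \<open>r / 2\<close>.\<close>
    define t where "t = r / 2 / (norm (y - p) + 1)"
    have t: "0 < t" using r by (simp add: t_def add_nonneg_pos)
    have "norm (t *\<^sub>R (y - p)) < r"
    proof -
      have "norm (t *\<^sub>R (y - p)) \<le> t * (norm (y - p) + 1)" using t by simp
      also have "\<dots> = r / 2" unfolding t_def by (simp add: field_simps add_nonneg_eq_0_iff)
      finally show ?thesis using r by simp
    qed
    then have "p + t *\<^sub>R (y - p) \<in> C" using r(2) by (auto simp: dist_norm subset_eq)
    from closest_point_dot[OF C(2) closed this, of y]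
    have "t * (norm (y - p))\<^sup>2 \<le> 0" by (simp add: p_def[symmetric] power2_norm_eq_inner)
    then have "y = p" using t by (simp add: mult_le_0_iff)
    then show False using p assms by simp
  qed
  moreover have "p \<in> closure C" using p closure_subset by blast
  ultimately show ?thesis unfolding frontier_def p_def[symmetric] by simp
qed

text \<open>A compact set is not the whole space, so \<open>C\<close> has a boundary point. Hence
  the supremum defining \<open>psiC\<close> ranges over a nonempty set.\<close>

lemma psiC_index_nonempty: "\<exists>x. (x, 0) \<in> {(x, v). x \<in> frontier C \<and> v \<in> insert 0 (support_vecs C x)}"
proof -
  have "C \<noteq> UNIV" using C compact_imp_bounded not_bounded_UNIV by blast
  then have "frontier C \<noteq> {}" using C frontier_not_empty by metis
  then show ?thesis by auto
qed

lemma psiC_bdd_above: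
  "bdd_above ((\<lambda>p. snd p \<bullet> (y - fst p)) ` {(x, v). x \<in> frontier C \<and> v \<in> insert 0 (support_vecs C x)})"
proof -
  obtain B where B: "\<And>x. x \<in> C \<Longrightarrow> norm x \<le> B" using C compact_imp_bounded bounded_iff by metis
  have "v \<bullet> (y - x) \<le> norm y + B" if "x \<in> frontier C" "v \<in> insert 0 (support_vecs C x)" for x v
  proof -
    have x: "x \<in> C" using that C frontier_subset_closed compact_imp_closed by blast
    have "v \<bullet> (y - x) \<le> norm v * norm (y - x)" by (rule norm_cauchy_schwarz)
    also have "\<dots> \<le> 1 * norm (y - x)"
      using that by (intro mult_right_mono) (auto simp: support_vecs_def)
    also have "\<dots> \<le> norm y + norm x" using norm_triangle_ineq4[of y x] by simp
    finally show ?thesis using B[OF x] by simp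
  qed
  note le = this
  show ?thesis
  proof (rule bdd_aboveI)
    fix u assume "u \<in> (\<lambda>p. snd p \<bullet> (y - fst p)) ` {(x, v). x \<in> frontier C \<and> v \<in> insert 0 (support_vecs C x)}"
    then obtain p where p: "u = snd p \<bullet> (y - fst p)"
        "p \<in> {(x, v). x \<in> frontier C \<and> v \<in> insert 0 (support_vecs C x)}" by blast
    then show "u \<le> norm y + B" using le[of "fst p" "snd p"] by (simp add: case_prod_unfold)
  qed
qed

lemma psiC_ge:
  assumes "x \<in> frontier C" "v \<in> insert 0 (support_vecs C x)"
  shows "v \<bullet> (y - x) \<le> psiC C y"
  unfolding psiC_def using cSUP_upper[OF _ psiC_bdd_above, of "(x, v)" y] assms by simp

lemma psiC_nonneg: "0 \<le> psiC C y"
  using psiC_index_nonempty psiC_ge[of _ 0 y] by auto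

lemma psiC_eq_0:
  assumes "y \<in> C" shows "psiC C y = 0"
proof -
  have "psiC C y \<le> 0"
    unfolding psiC_def using psiC_index_nonempty assms
    by (intro cSUP_least) (auto simp: support_vecs_def)
  then show ?thesis using psiC_nonneg[of y] by simp
qed

text \<open>For \<open>y\<close> outside \<open>C\<close>, the unit vector from the projection
  towards \<open>y\<close> is a support vector at the projection, and this pair contributes exactly
  the distance to the supremum.\<close>

lemma norm_closest_point_le_psiC: "norm (y - closest_point C y) \<le> psiC C y"
proof (cases "y \<in> C")
  case True
  then show ?thesis by (simp add: closest_point_self psiC_nonneg)
next
  case False
  define p d where "p = closest_point C y" and "d = y - p"
  have closed: "closed C" using C by (simp add: compact_imp_closed)
  have "p \<in> C" unfolding p_def using closed C by (intro closest_point_in_set)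
  then have d: "norm d > 0" using False by (auto simp: d_def)
  have "(d /\<^sub>R norm d) \<bullet> (x - p) \<le> 0" if "x \<in> C" for x
    using closest_point_dot[OF C(2) closed that, of y] d
    by (simp add: p_def[symmetric] d_def[symmetric] mult_le_0_iff)
  then have "d /\<^sub>R norm d \<in> support_vecs C p" using d by (simp add: support_vecs_def)
  then have "(d /\<^sub>R norm d) \<bullet> (y - p) \<le> psiC C y"
    using closest_point_frontier[OF False] by (intro psiC_ge) (auto simp: p_def)
  moreover have "(d /\<^sub>R norm d) \<bullet> d = norm d"
    using d by (simp add: dot_square_norm power2_eq_square)
  ultimately show ?thesis by (simp add: d_def p_def)
qed

end

section \<open>The uniform distribution on a ball\<close>

lemma space_eta [simp]: "space (eta r) = UNIV"
  by (simp add: eta_def)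

lemma sets_eta [simp, measurable_cong]: "sets (eta r) = sets borel"
  by (simp add: eta_def)

lemma emeasure_cball_pos:
  assumes "0 < r"
  shows "emeasure lborel (cball 0 r :: 'a::euclidean_space set) \<noteq> 0"
    "emeasure lborel (cball 0 r :: 'a set) < \<infinity>"
  using assms by (simp_all add: emeasure_cball ennreal_eq_0_iff not_le)

lemma prob_space_eta: "0 < r \<Longrightarrow> prob_space (eta r)"
  unfolding eta_def using emeasure_cball_pos by (intro prob_space_uniform_measure) (auto simp: less_top)

lemma AE_eta: "0 < r \<Longrightarrow> AE v in eta r. norm v \<le> r"
  unfolding eta_def by (subst AE_uniform_measure[OF emeasure_cball_pos]) auto

locale penalized_problem = D: prob_space D for D :: "'w measure" +
  fixes C :: "'a::euclidean_space set" and gh :: "'w \<Rightarrow> 'a \<Rightarrow> 'a" and f :: "'a \<Rightarrow> real"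
    and gf dpsi :: "'a \<Rightarrow> 'a" and G :: real and uopt u1 :: 'a
  assumes C: "compact C" "convex C" "C \<noteq> {}"
    and gh_bound: "\<And>w x. w \<in> space D \<Longrightarrow> norm (gh w x) \<le> G"
    and gh_meas: "(\<lambda>(w, x). gh w x) \<in> borel_measurable (D \<Otimes>\<^sub>M borel)"
    and gf_mean: "\<And>x. gf x = (\<integral>w. gh w x \<partial>D)"
    and gf_subgrad: "\<And>x. is_subgrad f x (gf x)"
    and gf_bound: "\<And>x. norm (gf x) \<le> G"
    and dpsi_subgrad: "\<And>y. is_subgrad (psiC C) y (dpsi y)"
    and dpsi_bound: "\<And>y. norm (dpsi y) \<le> 1"
    and dpsi_meas [measurable]: "dpsi \<in> borel_measurable borel"
    and uopt: "uopt \<in> C" "\<And>x. x \<in> C \<Longrightarrow> f uopt \<le> f x"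
begin

section \<open>The penalized objective\<close>

definition F :: "'a \<Rightarrow> real" where "F x = f x + 2 * G * psiC C x"
definition gF :: "'a \<Rightarrow> 'a" where "gF x = gf x + (2 * G) *\<^sub>R dpsi x"
definition h :: "'w \<Rightarrow> 'a \<Rightarrow> 'a" where "h w x = gh w x + (2 * G) *\<^sub>R dpsi x"

lemma G_nonneg: "0 \<le> G"
  using gf_bound[of 0] norm_ge_zero order_trans by blast

lemma f_lipschitz: "\<bar>f x - f y\<bar> \<le> G * norm (x - y)"
  by (rule subgrad_lipschitz[OF gf_subgrad gf_bound])

lemma F_subgrad: "is_subgrad F x (gF x)"
  unfolding F_def[abs_def] gF_def
  by (intro is_subgrad_add gf_subgrad is_subgrad_mult dpsi_subgrad) (use G_nonneg in simp)

lemma norm_penalized_le: "norm a \<le> G \<Longrightarrow> norm (a + (2 * G) *\<^sub>R dpsi x) \<le> 3 * G"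
  using norm_triangle_ineq[of a "(2 * G) *\<^sub>R dpsi x"] mult_left_mono[OF dpsi_bound, of "2 * G" x] G_nonneg
  by simp

lemma norm_gF: "norm (gF x) \<le> 3 * G"
  unfolding gF_def by (intro norm_penalized_le gf_bound)

lemma norm_h: "w \<in> space D \<Longrightarrow> norm (h w x) \<le> 3 * G"
  unfolding h_def by (intro norm_penalized_le gh_bound)

lemma F_lipschitz: "\<bar>F x - F y\<bar> \<le> 3 * G * norm (x - y)"
  by (rule subgrad_lipschitz[OF F_subgrad norm_gF])

lemma F_measurable [measurable]: "F \<in> borel_measurable borel"
  by (rule borel_measurable_continuous_onI, rule lipschitz_abs_continuous[OF F_lipschitz]) (use G_nonneg in simp)

lemma h_meas: "(\<lambda>(w, x). h w x) \<in> borel_measurable (D \<Otimes>\<^sub>M borel)"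
  using gh_meas unfolding h_def by measurable

lemma h_meas1 [measurable]: "(\<lambda>w. h w x) \<in> borel_measurable D"
  using measurable_compose[OF measurable_Pair2' h_meas, of x] by simp

lemma integral_h: "(\<integral>w. h w x \<partial>D) = gF x"
proof -
  have "(\<lambda>w. gh w x) \<in> borel_measurable D"
    using measurable_compose[OF measurable_Pair2' gh_meas, of x] by simp
  then have "integrable D (\<lambda>w. gh w x)"
    by (intro D.integrable_const_bound[of _ G]) (auto intro!: AE_I2 gh_bound)
  then show ?thesis by (simp add: h_def gF_def gf_mean D.prob_space)
qed

text \<open>Projecting raises \<open>f\<close> by at most \<open>G\<close> times the distance to
  \<open>C\<close>, and the penalty is at least twice that.\<close>

lemma f_projection_le: "f (closest_point C x) \<le> F x"
proof -
  have "f (closest_point C x) - f x \<le> G * norm (x - closest_point C x)"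
    using f_lipschitz[of "closest_point C x" x] by (simp add: norm_minus_commute)
  also have "\<dots> \<le> G * psiC C x"
    using G_nonneg by (intro mult_left_mono norm_closest_point_le_psiC C)
  also have "\<dots> \<le> 2 * G * psiC C x" using G_nonneg psiC_nonneg[OF C, of x] by simp
  finally show ?thesis by (simp add: F_def)
qed

text \<open>Constrained optimality becomes unconstrained, as every value of \<open>F\<close>
  dominates a value of \<open>f\<close> on \<open>C\<close>.\<close>

lemma F_ge: "f uopt \<le> F x"
  using f_projection_le[of x] uopt(2)[of "closest_point C x"] C
  by (meson closest_point_in_set compact_imp_closed order_trans)

lemma F_uopt: "F uopt = f uopt"
  by (simp add: F_def psiC_eq_0[OF C uopt(1)])

lemma excess_measurable: "(\<lambda>x. f (closest_point C x) - f uopt) \<in> borel_measurable borel"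
proof -
  have "continuous_on UNIV (\<lambda>x. f (closest_point C x))"
    by (intro continuous_on_compose2[OF lipschitz_abs_continuous[OF f_lipschitz G_nonneg, of UNIV]
      continuous_on_closest_point] C compact_imp_closed) auto
  from borel_measurable_continuous_onI[OF this] show ?thesis by measurable
qed

text \<open>The instance with rate constant 1 and comparison error 0, since \<open>uopt\<close>
  minimizes \<open>F\<close> on the whole space.\<close>

lemma sgd_out_bound:
  assumes "0 < a" "gap_rate (norm (u1 - uopt)) (3 * G) 1 0 T + a \<le> b"
  shows "measure (PiM UNIV (\<lambda>_::nat. D))
      {\<omega> \<in> space (PiM UNIV (\<lambda>_::nat. D)).
         f (sgd_out C gh dpsi G (\<lambda>s. 1 / sqrt (real s)) u1 T \<omega>) - f uopt
           \<le> b}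
    \<ge> 1 - noise_rate (norm (u1 - uopt)) (3 * G) 1 0 T / a\<^sup>2"
proof -
  interpret S: sgd_process D h F u1 uopt "3 * G" 1 "f uopt" 0
    by unfold_locales (auto simp: h_meas norm_h integral_h F_subgrad F_ge F_uopt)
  have "sgd_iter gh dpsi G (\<lambda>s. 1 / sqrt (real s)) u1 \<omega> (\<lambda>_. 0) t = S.X t \<omega>" for t \<omega>
    by (induction t) (simp_all add: S.rate_def h_def[symmetric] Let_def)
  moreover have "f (closest_point C x) - f uopt \<le> F x - f uopt" for x using f_projection_le by simp
  ultimately show ?thesis
    using S.last_iterate_high_probability_le[OF assms(1) excess_measurable _ assms(2)] by (simp add: sgd_out_def)
qed

section \<open>Smoothing by averages over balls\<close>

definition Fs :: "real \<Rightarrow> 'a \<Rightarrow> real" where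
  "Fs r x = (\<integral>v. F (x - v) \<partial>eta r)"

context
  fixes r :: real assumes r: "0 < r"
begin

interpretation Q: prob_space "eta r :: 'a measure" by (rule prob_space_eta[OF r])
interpretation DQ: pair_prob_space D "eta r :: 'a measure" ..

text \<open>Only almost everywhere, because \<open>eta r\<close> is a measure on the whole space
  that is concentrated on the ball.\<close>

lemma F_shift_AE: "AE v in eta r. \<bar>F (x - v) - F x\<bar> \<le> 3 * G * r"
  using AE_eta[OF r]
proof eventually_elim
  case (elim v)
  have "\<bar>F (x - v) - F x\<bar> \<le> 3 * G * norm v" using F_lipschitz[of "x - v" x] by simp
  also have "\<dots> \<le> 3 * G * r" using elim G_nonneg by (intro mult_left_mono) auto
  finally show ?case .
qed

lemma integrable_F_shift: "integrable (eta r) (\<lambda>v. F (x - v))"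
proof (rule Q.integrable_const_bound)
  show "AE v in eta r. norm (F (x - v)) \<le> \<bar>F x\<bar> + 3 * G * r"
    using F_shift_AE[of x] by eventually_elim (simp add: abs_le_iff, linarith)
qed measurable

lemma Fs_close: "\<bar>Fs r x - F x\<bar> \<le> 3 * G * r"
proof -
  have "\<bar>\<integral>v. F (x - v) - F x \<partial>eta r\<bar> \<le> (\<integral>v. \<bar>F (x - v) - F x\<bar> \<partial>eta r)"
    by (rule integral_abs_bound)
  also have "\<dots> \<le> (\<integral>v. 3 * G * r \<partial>(eta r :: 'a measure))"
    by (intro integral_mono_AE F_shift_AE integrable_abs Bochner_Integration.integrable_diff integrable_F_shift) auto
  finally show ?thesis
    using Q.prob_space by (simp add: Fs_def integrable_F_shift)
qed

lemma h_shift_meas: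
  "(\<lambda>(s, x). h (fst s) (x - snd s)) \<in> borel_measurable ((D \<Otimes>\<^sub>M eta r) \<Otimes>\<^sub>M borel)"
proof -
  have "(\<lambda>(s, x). (fst s, x - snd s)) \<in> (D \<Otimes>\<^sub>M eta r) \<Otimes>\<^sub>M borel \<rightarrow>\<^sub>M D \<Otimes>\<^sub>M (borel :: 'a measure)"
    by measurable
  from measurable_compose[OF this h_meas] show ?thesis by (simp add: case_prod_beta')
qed

text \<open>Fubini: integrating over the random function first turns \<open>h\<close> into
  \<open>gF\<close>, and the average over the perturbation remains.\<close>

lemma integral_h_shift: "(\<integral>s. h (fst s) (x - snd s) \<partial>(D \<Otimes>\<^sub>M eta r)) = (\<integral>v. gF (x - v) \<partial>eta r)"
  and integrable_gF_shift: "integrable (eta r) (\<lambda>v. gF (x - v))"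
proof -
  have "(\<lambda>s. h (fst s) (x - snd s)) \<in> borel_measurable (D \<Otimes>\<^sub>M eta r)"
    using measurable_compose[OF measurable_Pair2' h_shift_meas, of x] by simp
  then have "integrable (D \<Otimes>\<^sub>M eta r) (\<lambda>s. h (fst s) (x - snd s))"
    by (rule DQ.P.integrable_const_bound[rotated]) (auto intro!: AE_I2 norm_h simp: space_pair_measure)
  then have int: "integrable (D \<Otimes>\<^sub>M eta r) (\<lambda>(w, v). h w (x - v))" by (simp add: case_prod_beta')
  show "(\<integral>s. h (fst s) (x - snd s) \<partial>(D \<Otimes>\<^sub>M eta r)) = (\<integral>v. gF (x - v) \<partial>eta r)"
    using DQ.integral_snd[OF int] by (simp add: case_prod_beta' integral_h)
  show "integrable (eta r) (\<lambda>v. gF (x - v))"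
    using DQ.integrable_snd[OF int] by (simp add: integral_h)
qed

text \<open>The subgradient inequality for \<open>F\<close> between \<open>x - v\<close> and
  \<open>y - v\<close> is averaged over \<open>v\<close>; the difference of these points does not
  depend on \<open>v\<close>.\<close>

lemma Fs_subgrad: "is_subgrad (Fs r) x (\<integral>v. gF (x - v) \<partial>eta r)"
  unfolding is_subgrad_def
proof
  fix y
  have "Fs r x + (\<integral>v. gF (x - v) \<partial>eta r) \<bullet> (y - x) = (\<integral>v. F (x - v) + gF (x - v) \<bullet> (y - x) \<partial>eta r)"
    by (simp add: Fs_def integrable_F_shift integrable_gF_shift)
  also have "\<dots> \<le> Fs r y" unfolding Fs_def
  proof (intro integral_mono Bochner_Integration.integrable_add integrable_F_shift integrable_inner_left integrable_gF_shift)
    fix v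
    show "F (x - v) + gF (x - v) \<bullet> (y - x) \<le> F (y - v)"
      using F_subgrad[of "x - v"] unfolding is_subgrad_def by (auto dest: spec[of _ "y - v"])
  qed
  finally show "Fs r y \<ge> Fs r x + (\<integral>v. gF (x - v) \<partial>eta r) \<bullet> (y - x)" .
qed

text \<open>Smoothing changes \<open>F\<close> by at most \<open>3 * G * r\<close>. Lowering the
  reference value by this amount makes it a lower bound of \<open>Fs r\<close>, and
  \<open>uopt\<close> is then optimal up to \<open>6 * G * r\<close>.\<close>

lemma ssgd_out_bound:
  assumes "0 < a" "gap_rate (norm (u1 - uopt)) (3 * G) r (6 * G * r) T + a \<le> b"
  shows "measure (PiM UNIV (\<lambda>_::nat. D \<Otimes>\<^sub>M eta r))
      {\<omega> \<in> space (PiM UNIV (\<lambda>_::nat. D \<Otimes>\<^sub>M eta r)).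
         f (ssgd_out C gh dpsi G (\<lambda>s. r / sqrt (real s)) u1 T \<omega>) - f uopt
           \<le> b}
    \<ge> 1 - noise_rate (norm (u1 - uopt)) (3 * G) r (6 * G * r) T / a\<^sup>2"
proof -
  interpret S: sgd_process "D \<Otimes>\<^sub>M eta r" "\<lambda>s x. h (fst s) (x - snd s)" "Fs r" u1 uopt "3 * G" r
    "f uopt - 3 * G * r" "6 * G * r"
  proof unfold_locales
    show "f uopt - 3 * G * r \<le> Fs r x" for x using Fs_close[of x] F_ge[of x] by linarith
    show "Fs r uopt \<le> f uopt - 3 * G * r + 6 * G * r" using Fs_close[of uopt] F_uopt by linarith
  qed (auto simp: h_shift_meas norm_h integral_h_shift Fs_subgrad r space_pair_measure)
  have "sgd_iter gh dpsi G (\<lambda>s. r / sqrt (real s)) u1 (\<lambda>t. fst (\<omega> t)) (\<lambda>t. snd (\<omega> t)) t = S.X t \<omega>" for t \<omega>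
    by (induction t) (simp_all add: S.rate_def h_def[symmetric] Let_def)
  \<comment> \<open>The lowered reference value also pays for the passage from \<open>F\<close> to
    \<open>Fs r\<close>.\<close>
  moreover have "f (closest_point C x) - f uopt \<le> Fs r x - (f uopt - 3 * G * r)" for x
    using f_projection_le[of x] Fs_close[of x] by linarith
  ultimately show ?thesis
    using S.last_iterate_high_probability_le[OF assms(1) excess_measurable _ assms(2)] by (simp add: ssgd_out_def)
qed

end

end

section \<open>Asymptotics\<close>

text \<open>The exponent \<open>1/20\<close> only has to be so small that the powers of logarithms below cost less
  than the available slack in the powers of \<open>\<epsilon>\<close>.\<close>
lemma ln_power_over_sqrt_le:
  assumes Q: "0 < Q" "Q \<le> sqrt (real n + 1)" and kj: "real k / 20 \<le> real j"
  shows "(1 + ln (real n + 1)) ^ k / sqrt (real n + 1) ^ j \<le> 40 ^ k * Q powr (real k / 20 - real j)"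
proof -
  define q where "q = sqrt (real n + 1)"
  have q: "1 \<le> q" "Q \<le> q" using Q by (auto simp: q_def)
  have N: "real n + 1 = q\<^sup>2" by (simp add: q_def)
  \<comment> \<open>\<open>ln (q^2)\<close> is 40 times the left side, whence the constant 40; the
    resulting -40 absorbs the summand 1.\<close>
  have "ln (q powr (1 / 20)) \<le> q powr (1 / 20) - 1" using q by (intro ln_le_minus_one) auto
  then have "1 + ln (q\<^sup>2) \<le> 40 * q powr (1 / 20)" using q by (simp add: ln_powr ln_realpow)
  then have "(1 + ln (q\<^sup>2)) ^ k \<le> (40 * q powr (1 / 20)) ^ k"
    using q by (intro power_mono) (auto intro!: add_nonneg_nonneg)
  also have "\<dots> = 40 ^ k * q powr (real k / 20)"
    using q by (simp add: power_mult_distrib powr_realpow[symmetric] powr_powr)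
  finally have "(1 + ln (q\<^sup>2)) ^ k / q ^ j \<le> 40 ^ k * q powr (real k / 20) / q ^ j"
    using q by (intro divide_right_mono) auto
  also have "\<dots> = 40 ^ k * q powr (real k / 20 - real j)"
    using q by (simp add: powr_diff powr_realpow)
  also have "\<dots> \<le> 40 ^ k * Q powr (real k / 20 - real j)"
    using q Q kj by (intro mult_left_mono powr_mono2') auto
  finally show ?thesis unfolding N[symmetric] unfolding q_def .
qed

text \<open>\<open>Q\<close> is a lower bound for \<open>sqrt (n + 1)\<close>, which makes the
  estimate uniform over all larger \<open>n\<close>. Two logarithms over one square root give
  \<open>40 ^ 2 = 1600\<close> and the exponent \<open>2 / 20 - 1 = -9 / 10\<close>.\<close>

lemma gap_rate_le:
  assumes Q: "0 < Q" "Q \<le> sqrt (real n + 1)" and R: "0 \<le> R" "R \<le> d" and \<eta>: "0 < \<eta>"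
  shows "gap_rate R K \<eta> e n \<le> d\<^sup>2 / (2 * \<eta> * Q) + 1600 * K\<^sup>2 * \<eta> * Q powr (-9/10) + 2 * e"
proof -
  let ?l = "1 + ln (real n + 1)" and ?q = "sqrt (real n + 1)"
  have q: "0 < ?q" by simp
  have "gap_rate R K \<eta> e n = R\<^sup>2 / (2 * \<eta> * ?q) + K\<^sup>2 * \<eta> * (?l ^ 2 / ?q ^ 1) + 2 * e"
    using q \<eta> unfolding gap_rate_def by (simp add: field_simps)
  also have "\<dots> \<le> d\<^sup>2 / (2 * \<eta> * Q) + K\<^sup>2 * \<eta> * (40 ^ 2 * Q powr (real 2 / 20 - real 1)) + 2 * e"
    using Q R \<eta> by (intro add_mono mult_left_mono ln_power_over_sqrt_le frac_le power_mono) auto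
  finally show ?thesis by (simp add: mult_ac)
qed

text \<open>Five logarithms over two square roots give the exponent
  \<open>5 / 20 - 2 = -7 / 4\<close>, three over one give
  \<open>3 / 20 - 1 = -17 / 20\<close>.\<close>

lemma noise_rate_le:
  assumes Q: "0 < Q" "Q \<le> sqrt (real n + 1)" and R: "0 \<le> R" "R \<le> d" and \<eta>: "0 < \<eta>" "0 \<le> e"
  shows "noise_rate R K \<eta> e n \<le> 8 * K\<^sup>2 * ((3 * d\<^sup>2 + 7 * K\<^sup>2 * \<eta>\<^sup>2) * (40 ^ 5 * Q powr (-7/4))
     + 12 * e * \<eta> * (40 ^ 3 * Q powr (-17/20)))"
proof -
  let ?l = "1 + ln (real n + 1)" and ?q = "sqrt (real n + 1)"
  have q: "0 < ?q" and l: "1 \<le> ?l" by simp_all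
  have N: "real n + 1 = ?q ^ 2" by simp
  \<comment> \<open>The first summand receives the same squared logarithm as the second, so that one
    power estimate covers both.\<close>
  have "?l ^ 3 * ((3 * R\<^sup>2 + 7 * K\<^sup>2 * \<eta>\<^sup>2 * ?l\<^sup>2) / (?q ^ 2) + 12 * e * \<eta> / ?q)
      \<le> ?l ^ 3 * ((3 * d\<^sup>2 * ?l\<^sup>2 + 7 * K\<^sup>2 * \<eta>\<^sup>2 * ?l\<^sup>2) / (?q ^ 2) + 12 * e * \<eta> / ?q)"
  proof -
    have "R\<^sup>2 * 1 \<le> d\<^sup>2 * ?l\<^sup>2" using R l by (intro mult_mono power_mono one_le_power) auto
    then show ?thesis using l by (intro mult_left_mono add_right_mono divide_right_mono) auto
  qed
  also have "\<dots> = (3 * d\<^sup>2 + 7 * K\<^sup>2 * \<eta>\<^sup>2) * (?l ^ 5 / ?q ^ 2) + 12 * e * \<eta> * (?l ^ 3 / ?q ^ 1)"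
    by (simp add: add_divide_distrib distrib_left distrib_right power_numeral_reduce mult_ac)
  also have "\<dots> \<le> (3 * d\<^sup>2 + 7 * K\<^sup>2 * \<eta>\<^sup>2) * (40 ^ 5 * Q powr (real 5 / 20 - real 2))
      + 12 * e * \<eta> * (40 ^ 3 * Q powr (real 3 / 20 - real 1))"
    using \<eta> by (intro add_mono mult_left_mono ln_power_over_sqrt_le Q) auto
  finally have "8 * K\<^sup>2 * (?l ^ 3 * ((3 * R\<^sup>2 + 7 * K\<^sup>2 * \<eta>\<^sup>2 * ?l\<^sup>2) / (?q ^ 2) + 12 * e * \<eta> / ?q))
      \<le> 8 * K\<^sup>2 * ((3 * d\<^sup>2 + 7 * K\<^sup>2 * \<eta>\<^sup>2) * (40 ^ 5 * Q powr (real 5 / 20 - real 2))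
      + 12 * e * \<eta> * (40 ^ 3 * Q powr (real 3 / 20 - real 1)))"
    by (rule mult_left_mono) simp
  then show ?thesis unfolding noise_rate_def by (simp add: mult_ac)
qed

text \<open>Here \<open>Q = c / \<epsilon> ^ 3\<close>, and the three terms have orders 2, 37/10 and
  1 in \<open>\<epsilon>\<close>; the logarithm on the right beats the last one.\<close>

lemma asymp_smoothed_gap:
  fixes G d c :: real
  assumes "0 < G" "0 < d" "0 < c"
  shows "\<forall>\<^sub>F \<epsilon> in at_right 0. d\<^sup>2 / (2 * \<epsilon> * (c / \<epsilon> ^ 3)) + 1600 * (3 * G)\<^sup>2 * \<epsilon> * (c / \<epsilon> ^ 3) powr (-9/10)
      + 2 * (6 * G * \<epsilon>) \<le> 64 * G\<^sup>2 * \<epsilon> * ln (1 / \<epsilon>)"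
  using assms by real_asymp

text \<open>The larger term of the numerator has order 2 + 51/20 in \<open>\<epsilon>\<close>.
  Division by the squared deviation leaves an order above 2.\<close>

lemma asymp_smoothed_noise:
  fixes G d c :: real
  assumes "0 < G" "0 < d" "0 < c"
  shows "\<forall>\<^sub>F \<epsilon> in at_right 0. 8 * (3 * G)\<^sup>2 * ((3 * d\<^sup>2 + 7 * (3 * G)\<^sup>2 * \<epsilon>\<^sup>2) * (40 ^ 5 * (c / \<epsilon> ^ 3) powr (-7/4))
     + 12 * (6 * G * \<epsilon>) * \<epsilon> * (40 ^ 3 * (c / \<epsilon> ^ 3) powr (-17/20))) / (64 * G\<^sup>2 * \<epsilon> * ln (1 / \<epsilon>))\<^sup>2 \<le> 2 * \<epsilon>"
  using assms by real_asymp

text \<open>Here \<open>Q = c / \<epsilon> ^ 2\<close>, and the terms have orders 2 and 9/5 in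
  \<open>\<epsilon>\<close>.\<close>

lemma asymp_gap:
  fixes G d c :: real
  assumes "0 < G" "0 < d" "0 < c"
  shows "\<forall>\<^sub>F \<epsilon> in at_right 0. d\<^sup>2 / (2 * 1 * (c / \<epsilon> ^ 2)) + 1600 * (3 * G)\<^sup>2 * 1 * (c / \<epsilon> ^ 2) powr (-9/10)
      + 2 * 0 \<le> 64 * G\<^sup>2 * \<epsilon> * ln (1 / \<epsilon>)"
  using assms by real_asymp

text \<open>The numerator has order 7/2 in \<open>\<epsilon>\<close>, so order 3/2 remains after
  division by the squared deviation, up to logarithms.\<close>

lemma asymp_noise:
  fixes G d c :: real
  assumes "0 < G" "0 < d" "0 < c"
  shows "\<forall>\<^sub>F \<epsilon> in at_right 0. 8 * (3 * G)\<^sup>2 * ((3 * d\<^sup>2 + 7 * (3 * G)\<^sup>2 * 1\<^sup>2) * (40 ^ 5 * (c / \<epsilon> ^ 2) powr (-7/4))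
     + 12 * 0 * 1 * (40 ^ 3 * (c / \<epsilon> ^ 2) powr (-17/20))) / (64 * G\<^sup>2 * \<epsilon> * ln (1 / \<epsilon>))\<^sup>2 \<le> 2 * \<epsilon>"
  using assms by real_asymp

text \<open>The \<open>- 1\<close> in the threshold matches the \<open>T + 1\<close> under the root,
  through which iterate \<open>T\<close>, counted from 0, enters all bounds.\<close>

lemma sqrt_ge_of_ceiling_square:
  assumes "0 \<le> x" "int T \<ge> \<lceil>x + 1\<rceil> ^ 2 - 1"
  shows "x \<le> sqrt (real T + 1)"
proof -
  have "x + 1 \<le> of_int \<lceil>x + 1\<rceil>" by (rule le_of_int_ceiling)
  then have "(x + 1)\<^sup>2 \<le> (of_int \<lceil>x + 1\<rceil>)\<^sup>2" using assms(1) by (intro power_mono) auto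
  also have "\<dots> = of_int (\<lceil>x + 1\<rceil>\<^sup>2)" by simp
  also have "\<dots> \<le> of_int (int T + 1)" using assms(2) by (subst of_int_le_iff) linarith
  finally have "x + 1 \<le> sqrt (real T + 1)" by (intro real_le_rsqrt) simp
  then show ?thesis by simp
qed

section \<open>The two regimes combined\<close>

theorem theorem3p7:
  fixes C :: "'a::euclidean_space set"
    and D :: "'w measure"
    and fhat :: "'w \<Rightarrow> 'a \<Rightarrow> real"
    and gh :: "'w \<Rightarrow> 'a \<Rightarrow> 'a"
    and f :: "'a \<Rightarrow> real"
    and gf :: "'a \<Rightarrow> 'a"
    and dpsi :: "'a \<Rightarrow> 'a"
    and G L :: real
    and uopt u1 :: 'a
  assumes C: "compact C" "convex C" "C \<noteq> {}"
    and D: "prob_space D"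
    and fhat_convex: "\<And>w. w \<in> space D \<Longrightarrow> convex_on UNIV (fhat w)"
    and gh_subgrad: "\<And>w x. w \<in> space D \<Longrightarrow> is_subgrad (fhat w) x (gh w x)"
    and gh_bound: "\<And>w x. w \<in> space D \<Longrightarrow> norm (gh w x) \<le> G"
    and gh_meas: "(\<lambda>(w, x). gh w x) \<in> borel_measurable (D \<Otimes>\<^sub>M borel)"
    and fhat_int: "\<And>x. integrable D (\<lambda>w. fhat w x)"
    and gh_int: "\<And>x. integrable D (\<lambda>w. gh w x)"
    and f_mean: "\<And>x. f x = (\<integral>w. fhat w x \<partial>D)"
    and gf_mean: "\<And>x. gf x = (\<integral>w. gh w x \<partial>D)"
    and f_convex: "convex_on UNIV f"
    and gf_subgrad: "\<And>x. is_subgrad f x (gf x)"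
    and gf_bound: "\<And>x. norm (gf x) \<le> G"
    and dpsi_subgrad: "\<And>y. is_subgrad (psiC C) y (dpsi y)"
    and dpsi_bound: "\<And>y. norm (dpsi y) \<le> 1"
    and dpsi_meas: "dpsi \<in> borel_measurable borel"
    and uopt: "uopt \<in> C" "\<And>x. x \<in> C \<Longrightarrow> f uopt \<le> f x"
    and u1: "u1 \<in> C"
  shows
    "(\<forall>\<delta>>0. \<forall>\<^sub>F \<epsilon> in at_right 0. \<forall>T::nat.
        int T \<ge> \<lceil>3 * G * diameter C / (2 * \<epsilon> ^ 3) + 1\<rceil> ^ 2 - 1 \<longrightarrow>
        measure (PiM UNIV (\<lambda>_::nat. D \<Otimes>\<^sub>M eta \<epsilon>))
          {\<omega> \<in> space (PiM UNIV (\<lambda>_::nat. D \<Otimes>\<^sub>M eta \<epsilon>)).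
             f (ssgd_out C gh dpsi G (\<lambda>s. \<epsilon> / sqrt (real s)) u1 T \<omega>) - f uopt
               \<le> (1 + \<delta>) * (128 * G ^ 2 * \<epsilon> * ln (1 / \<epsilon>))}
          \<ge> 1 - (1 + \<delta>) * (2 * \<epsilon>))
     \<and>
     ((\<forall>x y. norm (gf x - gf y) \<le> L * dist x y) \<longrightarrow>
      (\<forall>\<delta>>0. \<forall>\<^sub>F \<epsilon> in at_right 0. \<forall>T::nat.
        int T \<ge> \<lceil>3 * G * diameter C / (2 * \<epsilon> ^ 2) + 1\<rceil> ^ 2 - 1 \<longrightarrow>
        measure (PiM UNIV (\<lambda>_::nat. D))
          {\<omega> \<in> space (PiM UNIV (\<lambda>_::nat. D)).
             f (sgd_out C gh dpsi G (\<lambda>s. 1 / sqrt (real s)) u1 T \<omega>) - f uopt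
               \<le> (1 + \<delta>) * (128 * G ^ 2 * \<epsilon> * ln (1 / \<epsilon>))}
          \<ge> 1 - (1 + \<delta>) * (2 * \<epsilon>)))"
proof -
  interpret penalized_problem D C gh f gf dpsi G uopt u1
    by (intro penalized_problem.intro penalized_problem_axioms.intro) (use assms in auto)
  define c d R where "c = 3 * G * diameter C / 2" and "d = diameter C" and "R = norm (u1 - uopt)"
  have bounded: "bounded C" using C by (simp add: compact_imp_bounded)
  have R: "0 \<le> R" "R \<le> d"
    using diameter_bounded_bound[OF bounded u1 uopt(1)] by (auto simp: R_def d_def dist_norm)
  have proj: "closest_point C x \<in> C" for x using C by (simp add: closest_point_in_set compact_imp_closed)
  \<comment> \<open>For \<open>G = 0\<close> or a one-point \<open>C\<close> the constant
    \<open>c\<close> vanishes and the asymptotic estimates do not apply, but \<open>f\<close> is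
    then constant on \<open>C\<close>.\<close>
  have degenerate: "f y = f uopt" if "\<not> (0 < G \<and> 0 < d)" "y \<in> C" for y
  proof -
    have "norm (y - uopt) \<le> d"
      using diameter_bounded_bound[OF bounded that(2) uopt(1)] by (simp add: d_def dist_norm)
    then have "\<bar>f y - f uopt\<bar> \<le> G * d"
      using f_lipschitz[of y uopt] G_nonneg mult_left_mono by (meson order_trans)
    moreover have "G * d = 0" using that(1) G_nonneg diameter_ge_0[OF bounded] by (auto simp: d_def)
    ultimately show ?thesis by simp
  qed
  have unit: "\<forall>\<^sub>F \<epsilon> in at_right (0::real). \<epsilon> \<in> {0<..<1}" by (rule eventually_at_right_real) simp
  have thr: "c / \<epsilon> ^ p \<le> sqrt (real T + 1)"
    if "int T \<ge> \<lceil>3 * G * diameter C / (2 * \<epsilon> ^ p) + 1\<rceil> ^ 2 - 1" "0 < \<epsilon>" for T p \<epsilon>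
  proof (rule sqrt_ge_of_ceiling_square)
    show "0 \<le> c / \<epsilon> ^ p" using that G_nonneg diameter_ge_0[OF bounded] by (simp add: c_def)
    show "int T \<ge> \<lceil>c / \<epsilon> ^ p + 1\<rceil> ^ 2 - 1" using that by (simp add: c_def)
  qed
  \<comment> \<open>The constant 128 is split evenly between the deterministic bound and the
    deviation. The factor \<open>1 + \<delta>\<close> only relaxes the conclusions, as the logarithm
    is positive for \<open>\<epsilon> < 1\<close>.\<close>
  have target: "2 * (64 * G\<^sup>2 * \<epsilon> * ln (1 / \<epsilon>)) \<le> (1 + \<delta>) * (128 * G ^ 2 * \<epsilon> * ln (1 / \<epsilon>))"
    and prob: "1 - (1 + \<delta>) * (2 * \<epsilon>) \<le> 1 - 2 * \<epsilon>" if "\<epsilon> \<in> {0<..<1}" "0 < \<delta>" for \<epsilon> \<delta> :: real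
  proof -
    have "0 \<le> 128 * G ^ 2 * \<epsilon> * ln (1 / \<epsilon>)" using that by simp
    from mult_right_mono[OF _ this, of 1 "1 + \<delta>"] that
    show "2 * (64 * G\<^sup>2 * \<epsilon> * ln (1 / \<epsilon>)) \<le> (1 + \<delta>) * (128 * G ^ 2 * \<epsilon> * ln (1 / \<epsilon>))" by simp
    show "1 - (1 + \<delta>) * (2 * \<epsilon>) \<le> 1 - 2 * \<epsilon>" using that by simp
  qed
  \<comment> \<open>In the degenerate case the event is the whole sample space, whatever the
    iterates are.\<close>
  have trivial: "measure M {\<omega> \<in> space M. f (closest_point C (Y \<omega>)) - f uopt
      \<le> (1 + \<delta>) * (128 * G ^ 2 * \<epsilon> * ln (1 / \<epsilon>))} \<ge> 1 - (1 + \<delta>) * (2 * \<epsilon>)"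
    if "\<not> (0 < G \<and> 0 < d)" "prob_space M" "\<epsilon> \<in> {0<..<1}" "0 < \<delta>" for M Y \<epsilon> \<delta>
  proof -
    interpret M: prob_space M by fact
    have "0 \<le> (1 + \<delta>) * (128 * G ^ 2 * \<epsilon> * ln (1 / \<epsilon>))" using that by simp
    then have "{\<omega> \<in> space M. f (closest_point C (Y \<omega>)) - f uopt
      \<le> (1 + \<delta>) * (128 * G ^ 2 * \<epsilon> * ln (1 / \<epsilon>))} = space M"
      using degenerate[OF that(1) proj] by auto
    then show ?thesis using that M.prob_space by simp
  qed
  show ?thesis
  proof (intro conjI impI allI)
    fix \<delta> :: real assume \<delta>: "0 < \<delta>"
    show "\<forall>\<^sub>F \<epsilon> in at_right 0. \<forall>T::nat.
        int T \<ge> \<lceil>3 * G * diameter C / (2 * \<epsilon> ^ 3) + 1\<rceil> ^ 2 - 1 \<longrightarrow>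
        measure (PiM UNIV (\<lambda>_::nat. D \<Otimes>\<^sub>M eta \<epsilon>))
          {\<omega> \<in> space (PiM UNIV (\<lambda>_::nat. D \<Otimes>\<^sub>M eta \<epsilon>)).
             f (ssgd_out C gh dpsi G (\<lambda>s. \<epsilon> / sqrt (real s)) u1 T \<omega>) - f uopt
               \<le> (1 + \<delta>) * (128 * G ^ 2 * \<epsilon> * ln (1 / \<epsilon>))}
          \<ge> 1 - (1 + \<delta>) * (2 * \<epsilon>)"
    proof (cases "0 < G \<and> 0 < d")
      case False
      from unit show ?thesis
      proof eventually_elim
        case (elim \<epsilon>)
        interpret Q: prob_space "eta \<epsilon> :: 'a measure" using elim by (intro prob_space_eta) simp
        interpret DQ: pair_prob_space D "eta \<epsilon> :: 'a measure" ..
        have PDQ: "prob_space (PiM UNIV (\<lambda>_::nat. D \<Otimes>\<^sub>M (eta \<epsilon> :: 'a measure)))"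
          by (intro prob_space_PiM DQ.P.prob_space_axioms)
        show ?case unfolding ssgd_out_def by (intro allI impI trivial[OF False PDQ elim \<delta>])
      qed
    next
      case True
      then have pos: "0 < G" "0 < d" "0 < c" by (auto simp: c_def d_def)
      from unit asymp_smoothed_gap[OF pos] asymp_smoothed_noise[OF pos] show ?thesis
      proof eventually_elim
        case (elim \<epsilon>)
        \<comment> \<open>Half of the target serves as the deviation in Chebyshev's
          inequality.\<close>
        define a where "a = 64 * G\<^sup>2 * \<epsilon> * ln (1 / \<epsilon>)"
        have \<epsilon>: "0 < \<epsilon>" and a: "0 < a" using elim(1) pos by (auto simp: a_def)
        show ?case
        proof (intro allI impI)
          fix T :: nat assume "int T \<ge> \<lceil>3 * G * diameter C / (2 * \<epsilon> ^ 3) + 1\<rceil> ^ 2 - 1"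
          then have T: "c / \<epsilon> ^ 3 \<le> sqrt (real T + 1)" using \<epsilon> by (rule thr)
          have c\<epsilon>: "0 < c / \<epsilon> ^ 3" using pos \<epsilon> by simp
          have "gap_rate R (3 * G) \<epsilon> (6 * G * \<epsilon>) T \<le> a"
            using order_trans[OF gap_rate_le[OF c\<epsilon> T R \<epsilon>, of "3 * G" "6 * G * \<epsilon>"]] elim(2)
            by (simp add: a_def)
          then have gap: "gap_rate R (3 * G) \<epsilon> (6 * G * \<epsilon>) T + a \<le> (1 + \<delta>) * (128 * G ^ 2 * \<epsilon> * ln (1 / \<epsilon>))"
            using target[OF elim(1) \<delta>] by (simp add: a_def)
          have "noise_rate R (3 * G) \<epsilon> (6 * G * \<epsilon>) T / a\<^sup>2 \<le> 2 * \<epsilon>"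
            using order_trans[OF divide_right_mono[OF noise_rate_le[OF c\<epsilon> T R \<epsilon>, of "6 * G * \<epsilon>" "3 * G"]]] elim(3) pos \<epsilon>
            by (simp add: a_def)
          with ssgd_out_bound[OF \<epsilon> a gap[unfolded R_def]] prob[OF elim(1) \<delta>]
          show "measure (PiM UNIV (\<lambda>_::nat. D \<Otimes>\<^sub>M eta \<epsilon>))
            {\<omega> \<in> space (PiM UNIV (\<lambda>_::nat. D \<Otimes>\<^sub>M eta \<epsilon>)).
               f (ssgd_out C gh dpsi G (\<lambda>s. \<epsilon> / sqrt (real s)) u1 T \<omega>) - f uopt
                 \<le> (1 + \<delta>) * (128 * G ^ 2 * \<epsilon> * ln (1 / \<epsilon>))}
            \<ge> 1 - (1 + \<delta>) * (2 * \<epsilon>)"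
            unfolding R_def[symmetric] by linarith
        qed
      qed
    qed
  next
    fix \<delta> :: real assume \<delta>: "0 < \<delta>"
    show "\<forall>\<^sub>F \<epsilon> in at_right 0. \<forall>T::nat.
        int T \<ge> \<lceil>3 * G * diameter C / (2 * \<epsilon> ^ 2) + 1\<rceil> ^ 2 - 1 \<longrightarrow>
        measure (PiM UNIV (\<lambda>_::nat. D))
          {\<omega> \<in> space (PiM UNIV (\<lambda>_::nat. D)).
             f (sgd_out C gh dpsi G (\<lambda>s. 1 / sqrt (real s)) u1 T \<omega>) - f uopt
               \<le> (1 + \<delta>) * (128 * G ^ 2 * \<epsilon> * ln (1 / \<epsilon>))}
          \<ge> 1 - (1 + \<delta>) * (2 * \<epsilon>)"
    proof (cases "0 < G \<and> 0 < d")
      case False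
      have PD: "prob_space (PiM UNIV (\<lambda>_::nat. D))" by (intro prob_space_PiM D)
      from unit show ?thesis
        unfolding sgd_out_def by eventually_elim (intro allI impI trivial[OF False PD _ \<delta>])
    next
      case True
      then have pos: "0 < G" "0 < d" "0 < c" by (auto simp: c_def d_def)
      from unit asymp_gap[OF pos] asymp_noise[OF pos] show ?thesis
      proof eventually_elim
        case (elim \<epsilon>)
        define a where "a = 64 * G\<^sup>2 * \<epsilon> * ln (1 / \<epsilon>)"
        have \<epsilon>: "0 < \<epsilon>" and a: "0 < a" using elim(1) pos by (auto simp: a_def)
        show ?case
        proof (intro allI impI)
          fix T :: nat assume "int T \<ge> \<lceil>3 * G * diameter C / (2 * \<epsilon> ^ 2) + 1\<rceil> ^ 2 - 1"
          then have T: "c / \<epsilon> ^ 2 \<le> sqrt (real T + 1)" using \<epsilon> by (rule thr)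
          have c\<epsilon>: "0 < c / \<epsilon> ^ 2" using pos \<epsilon> by simp
          have "gap_rate R (3 * G) 1 0 T \<le> a"
            using order_trans[OF gap_rate_le[OF c\<epsilon> T R zero_less_one, of "3 * G" 0]] elim(2)
            by (simp add: a_def)
          then have gap: "gap_rate R (3 * G) 1 0 T + a \<le> (1 + \<delta>) * (128 * G ^ 2 * \<epsilon> * ln (1 / \<epsilon>))"
            using target[OF elim(1) \<delta>] by (simp add: a_def)
          have "noise_rate R (3 * G) 1 0 T / a\<^sup>2 \<le> 2 * \<epsilon>"
            using order_trans[OF divide_right_mono[OF noise_rate_le[OF c\<epsilon> T R zero_less_one, of 0 "3 * G"]]] elim(3)
            by (simp add: a_def)
          with sgd_out_bound[OF a gap[unfolded R_def]] prob[OF elim(1) \<delta>]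
          show "measure (PiM UNIV (\<lambda>_::nat. D))
            {\<omega> \<in> space (PiM UNIV (\<lambda>_::nat. D)).
               f (sgd_out C gh dpsi G (\<lambda>s. 1 / sqrt (real s)) u1 T \<omega>) - f uopt
                 \<le> (1 + \<delta>) * (128 * G ^ 2 * \<epsilon> * ln (1 / \<epsilon>))}
            \<ge> 1 - (1 + \<delta>) * (2 * \<epsilon>)"
            unfolding R_def[symmetric] by linarith
        qed
      qed
    qed
  qed
qed

end
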